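(* Let $(X,r)$ be a non-degenerate symmetric set, $(G,r_G)$ its associated symmetric group and $(\mathcal{G},r_{\mathcal{G}})$ its permutation group with its symmetric group structure. Then: (1) $\mathrm{Ret}(\mathcal{G},r_{\mathcal{G}})\simeq \mathcal{G}(\mathrm{Ret}(X,r))$ as symmetric groups; (2) for every $j\ge0$ there is an isomorphism of symmetric groups $\mathrm{Ret}^{j+1}(G,r_G)\simeq \mathcal{G}(\mathrm{Ret}^j(X,r))$; (3) for every integer $m\ge0$, $\mathrm{mpl}(G,r_G)=m+1$ if and only if $\mathrm{mpl}(\mathcal{G},r_{\mathcal{G}})=m$.
   Context: A symmetric set is a pair $(X,r)$, $X$ nonempty, $r:X\times X\to X\times X$ a bijection $r(x,y)=({}^xy,x^y)$ that is non-degenerate (all $y\mapsto{}^xy$, $y\mapsto y^x$ bijective), involutive, and satisfies $r^{12}r^{23}r^{12}=r^{23}r^{12}r^{23}$ on $X^3$. $G=G(X,r)$ is the group generated by $X$ with relations $xy=zt$ whenever $r(x,y)=(z,t)$; $X$ embeds in $G$. A symmetric group is a pair $(G,\sigma)$, $G$ a group, $\sigma(u,v)=({}^uv,u^v)$ an involutive bijection of $G\times G$ with ${}^a1=1,{}^1u=u,1^u=1,a^1=a$, ${}^{ab}u={}^a({}^bu)$, $a^{uv}=(a^u)^v$, ${}^a(uv)=({}^au)({}^{a^u}v)$, $(ab)^u=(a^{{}^bu})(b^u)$, $uv=({}^uv)(u^v)$; $(G,r_G)$ is $G(X,r)$ with the unique such involutive braiding extending $r$. The left action $x\mapsto \mathcal{L}_x$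 ($\mathcal{L}_x(y)={}^xy$) extends to a homomorphism $\mathcal{L}:G\to\mathrm{Sym}(X)$; $\mathcal{G}(X,r)=\mathcal{L}(G)$. Its kernel equals $\mathrm{soc}(G)=\{a:{}^au=u\ \forall u\in G\}$, so $\mathcal{G}\cong G/\ker\mathcal{L}$ inherits a symmetric group structure $r_{\mathcal{G}}(\mathcal{L}_a,\mathcal{L}_b)=(\mathcal{L}_{{}^ab},\mathcal{L}_{a^b})$. Retraction: $\mathrm{Ret}(X,r)=(X/\!\sim,r_{[X]})$ with $x\sim y$ iff $\mathcal{L}_x=\mathcal{L}_y$, $r_{[X]}([x],[y])=([{}^xy],[x^y])$; for a symmetric group $\mathrm{Ret}(G,\sigma)\cong G/\mathrm{soc}(G)$ is again a symmetric group; $\mathrm{Ret}^j$ is the iterate; $\mathrm{mpl}=m$ means $m$ is minimal with $\mathrm{Ret}^m$ a one-element set. *)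

theory Defs
  imports "HOL-Algebra.Group" "HOL-Algebra.Coset" "HOL-Algebra.Bij"
begin

text \<open>A map r on X x X is written r x y = (left action of x on y, right action of y on x),
  i.e. r(x,y) = (x-left-y, x^y).\<close>

definition r12 :: "('a \<Rightarrow> 'a \<Rightarrow> 'a \<times> 'a) \<Rightarrow> 'a \<times> 'a \<times> 'a \<Rightarrow> 'a \<times> 'a \<times> 'a" where
  "r12 r t = (case t of (x, y, z) \<Rightarrow> (fst (r x y), snd (r x y), z))"

definition r23 :: "('a \<Rightarrow> 'a \<Rightarrow> 'a \<times> 'a) \<Rightarrow> 'a \<times> 'a \<times> 'a \<Rightarrow> 'a \<times> 'a \<times> 'a" where
  "r23 r t = (case t of (x, y, z) \<Rightarrow> (x, fst (r y z), snd (r y z)))"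

definition symmetric_set :: "'a set \<Rightarrow> ('a \<Rightarrow> 'a \<Rightarrow> 'a \<times> 'a) \<Rightarrow> bool" where
  "symmetric_set X r \<longleftrightarrow>
     X \<noteq> {} \<and>
     bij_betw (\<lambda>(x, y). r x y) (X \<times> X) (X \<times> X) \<and>
     (\<forall>x\<in>X. bij_betw (\<lambda>y. fst (r x y)) X X) \<and>
     (\<forall>x\<in>X. bij_betw (\<lambda>y. snd (r y x)) X X) \<and>
     (\<forall>x\<in>X. \<forall>y\<in>X. (\<lambda>(a, b). r a b) (r x y) = (x, y)) \<and>
     (\<forall>t\<in>X \<times> X \<times> X. r12 r (r23 r (r12 r t)) = r23 r (r12 r (r23 r t)))"

text \<open>Words over X and their inverses: (x, True) is the letter x, (x, False) is x^{-1}.\<close>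

definition words :: "'a set \<Rightarrow> ('a \<times> bool) list set" where
  "words X = {w. fst ` set w \<subseteq> X}"

inductive weq :: "'a set \<Rightarrow> ('a \<Rightarrow> 'a \<Rightarrow> 'a \<times> 'a) \<Rightarrow> ('a \<times> bool) list \<Rightarrow> ('a \<times> bool) list \<Rightarrow> bool"
  for X r where
  weq_refl: "w \<in> words X \<Longrightarrow> weq X r w w"
| weq_sym: "weq X r u v \<Longrightarrow> weq X r v u"
| weq_trans: "weq X r u v \<Longrightarrow> weq X r v w \<Longrightarrow> weq X r u w"
| weq_cancel: "u \<in> words X \<Longrightarrow> v \<in> words X \<Longrightarrow> x \<in> X \<Longrightarrow>
     weq X r (u @ [(x, b), (x, \<not> b)] @ v) (u @ v)"
| weq_rel: "u \<in> words X \<Longrightarrow> v \<in> words X \<Longrightarrow> x \<in> X \<Longrightarrow> y \<in> X \<Longrightarrow>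
     weq X r (u @ [(x, True), (y, True)] @ v) (u @ [(fst (r x y), True), (snd (r x y), True)] @ v)"

definition wclass :: "'a set \<Rightarrow> ('a \<Rightarrow> 'a \<Rightarrow> 'a \<times> 'a) \<Rightarrow> ('a \<times> bool) list \<Rightarrow> ('a \<times> bool) list set" where
  "wclass X r w = {v. weq X r w v}"

definition struct_group :: "'a set \<Rightarrow> ('a \<Rightarrow> 'a \<Rightarrow> 'a \<times> 'a) \<Rightarrow> ('a \<times> bool) list set monoid" where
  "struct_group X r =
     \<lparr>carrier = wclass X r ` words X,
      mult = (\<lambda>A B. wclass X r ((SOME u. u \<in> A) @ (SOME v. v \<in> B))),
      one = wclass X r []\<rparr>"

definition emb :: "'a set \<Rightarrow> ('a \<Rightarrow> 'a \<Rightarrow> 'a \<times> 'a) \<Rightarrow> 'a \<Rightarrow> ('a \<times> bool) list set" where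
  "emb X r x = wclass X r [(x, True)]"

definition lact :: "('g \<Rightarrow> 'g \<Rightarrow> 'g \<times> 'g) \<Rightarrow> 'g \<Rightarrow> 'g \<Rightarrow> 'g" where
  "lact \<sigma> a u = fst (\<sigma> a u)"

definition ract :: "('g \<Rightarrow> 'g \<Rightarrow> 'g \<times> 'g) \<Rightarrow> 'g \<Rightarrow> 'g \<Rightarrow> 'g" where
  "ract \<sigma> a u = snd (\<sigma> a u)"

definition symmetric_group :: "'g monoid \<Rightarrow> ('g \<Rightarrow> 'g \<Rightarrow> 'g \<times> 'g) \<Rightarrow> bool" where
  "symmetric_group G \<sigma> \<longleftrightarrow>
     group G \<and>
     (\<forall>a\<in>carrier G. \<forall>b\<in>carrier G. \<sigma> a b \<in> carrier G \<times> carrier G) \<and>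
     bij_betw (\<lambda>(a, b). \<sigma> a b) (carrier G \<times> carrier G) (carrier G \<times> carrier G) \<and>
     (\<forall>a\<in>carrier G. \<forall>b\<in>carrier G. (\<lambda>(u, v). \<sigma> u v) (\<sigma> a b) = (a, b)) \<and>
     (\<forall>a\<in>carrier G. lact \<sigma> a \<one>\<^bsub>G\<^esub> = \<one>\<^bsub>G\<^esub> \<and> lact \<sigma> \<one>\<^bsub>G\<^esub> a = a \<and>
                     ract \<sigma> \<one>\<^bsub>G\<^esub> a = \<one>\<^bsub>G\<^esub> \<and> ract \<sigma> a \<one>\<^bsub>G\<^esub> = a) \<and>
     (\<forall>a\<in>carrier G. \<forall>b\<in>carrier G. \<forall>u\<in>carrier G. \<forall>v\<in>carrier G.
        lact \<sigma> (a \<otimes>\<^bsub>G\<^esub> b) u = lact \<sigma> a (lact \<sigma> b u) \<and>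
        ract \<sigma> a (u \<otimes>\<^bsub>G\<^esub> v) = ract \<sigma> (ract \<sigma> a u) v \<and>
        lact \<sigma> a (u \<otimes>\<^bsub>G\<^esub> v) = lact \<sigma> a u \<otimes>\<^bsub>G\<^esub> lact \<sigma> (ract \<sigma> a u) v \<and>
        ract \<sigma> (a \<otimes>\<^bsub>G\<^esub> b) u = ract \<sigma> a (lact \<sigma> b u) \<otimes>\<^bsub>G\<^esub> ract \<sigma> b u \<and>
        u \<otimes>\<^bsub>G\<^esub> v = lact \<sigma> u v \<otimes>\<^bsub>G\<^esub> ract \<sigma> u v)"

definition sym_iso :: "'g monoid \<times> ('g \<Rightarrow> 'g \<Rightarrow> 'g \<times> 'g) \<Rightarrow> 'h monoid \<times> ('h \<Rightarrow> 'h \<Rightarrow> 'h \<times> 'h) \<Rightarrow> bool" where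
  "sym_iso S T \<longleftrightarrow>
     (\<exists>f. f \<in> iso (fst S) (fst T) \<and>
          (\<forall>a\<in>carrier (fst S). \<forall>b\<in>carrier (fst S).
              snd T (f a) (f b) = map_prod f f (snd S a b)))"

text \<open>The symmetric group (G, r_G): G = G(X,r) with the unique involutive braiding extending r.
  Outside the carrier the value is irrelevant (undefined).\<close>
definition struct_braiding :: "'a set \<Rightarrow> ('a \<Rightarrow> 'a \<Rightarrow> 'a \<times> 'a) \<Rightarrow>
    ('a \<times> bool) list set \<Rightarrow> ('a \<times> bool) list set \<Rightarrow> ('a \<times> bool) list set \<times> ('a \<times> bool) list set" where
  "struct_braiding X r a b =
     (if a \<in> carrier (struct_group X r) \<and> b \<in> carrier (struct_group X r) then
        (THE p. \<exists>\<sigma>. symmetric_group (struct_group X r) \<sigma> \<and>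
                     (\<forall>x\<in>X. \<forall>y\<in>X. \<sigma> (emb X r x) (emb X r y) =
                          (emb X r (fst (r x y)), emb X r (snd (r x y)))) \<and>
                     \<sigma> a b = p)
      else undefined)"

definition struct_symgroup :: "'a set \<Rightarrow> ('a \<Rightarrow> 'a \<Rightarrow> 'a \<times> 'a) \<Rightarrow>
    ('a \<times> bool) list set monoid \<times>
    (('a \<times> bool) list set \<Rightarrow> ('a \<times> bool) list set \<Rightarrow> ('a \<times> bool) list set \<times> ('a \<times> bool) list set)" where
  "struct_symgroup X r = (struct_group X r, struct_braiding X r)"

text \<open>L_a(y) = left action of a on y in (G, r_G), for y in X (identifying X with its image in G).\<close>
definition Lmap :: "'a set \<Rightarrow> ('a \<Rightarrow> 'a \<Rightarrow> 'a \<times> 'a) \<Rightarrow> ('a \<times> bool) list set \<Rightarrow> 'a \<Rightarrow> 'a" where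
  "Lmap X r a = (\<lambda>y\<in>X. the_inv_into X (emb X r) (lact (struct_braiding X r) a (emb X r y)))"

definition perm_group :: "'a set \<Rightarrow> ('a \<Rightarrow> 'a \<Rightarrow> 'a \<times> 'a) \<Rightarrow> ('a \<Rightarrow> 'a) monoid" where
  "perm_group X r = (BijGroup X)\<lparr>carrier := Lmap X r ` carrier (struct_group X r)\<rparr>"

definition perm_braiding :: "'a set \<Rightarrow> ('a \<Rightarrow> 'a \<Rightarrow> 'a \<times> 'a) \<Rightarrow>
    ('a \<Rightarrow> 'a) \<Rightarrow> ('a \<Rightarrow> 'a) \<Rightarrow> ('a \<Rightarrow> 'a) \<times> ('a \<Rightarrow> 'a)" where
  "perm_braiding X r p q =
     (if p \<in> carrier (perm_group X r) \<and> q \<in> carrier (perm_group X r) then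
        (let a = (SOME a. a \<in> carrier (struct_group X r) \<and> Lmap X r a = p);
             b = (SOME b. b \<in> carrier (struct_group X r) \<and> Lmap X r b = q)
         in (Lmap X r (lact (struct_braiding X r) a b), Lmap X r (ract (struct_braiding X r) a b)))
      else undefined)"

definition perm_symgroup :: "'a set \<times> ('a \<Rightarrow> 'a \<Rightarrow> 'a \<times> 'a) \<Rightarrow>
    ('a \<Rightarrow> 'a) monoid \<times> (('a \<Rightarrow> 'a) \<Rightarrow> ('a \<Rightarrow> 'a) \<Rightarrow> ('a \<Rightarrow> 'a) \<times> ('a \<Rightarrow> 'a))" where
  "perm_symgroup S = (perm_group (fst S) (snd S), perm_braiding (fst S) (snd S))"

text \<open>To be able to iterate, Ret is realised on the same carrier type by choosing a
  canonical representative (via SOME) of each equivalence class / coset; this is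
  isomorphic to the quotient construction.\<close>

definition set_rep :: "'a set \<Rightarrow> ('a \<Rightarrow> 'a \<Rightarrow> 'a \<times> 'a) \<Rightarrow> 'a \<Rightarrow> 'a" where
  "set_rep X r x = (SOME y. y \<in> X \<and> (\<forall>z\<in>X. fst (r y z) = fst (r x z)))"

definition RetS :: "'a set \<times> ('a \<Rightarrow> 'a \<Rightarrow> 'a \<times> 'a) \<Rightarrow> 'a set \<times> ('a \<Rightarrow> 'a \<Rightarrow> 'a \<times> 'a)" where
  "RetS S = (case S of (X, r) \<Rightarrow>
     (set_rep X r ` X, \<lambda>x y. map_prod (set_rep X r) (set_rep X r) (r x y)))"

definition soc :: "'g monoid \<Rightarrow> ('g \<Rightarrow> 'g \<Rightarrow> 'g \<times> 'g) \<Rightarrow> 'g set" where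
  "soc G \<sigma> = {a \<in> carrier G. \<forall>u\<in>carrier G. lact \<sigma> a u = u}"

definition grp_rep :: "'g monoid \<Rightarrow> ('g \<Rightarrow> 'g \<Rightarrow> 'g \<times> 'g) \<Rightarrow> 'g \<Rightarrow> 'g" where
  "grp_rep G \<sigma> a = (SOME b. b \<in> soc G \<sigma> #>\<^bsub>G\<^esub> a)"

definition RetG :: "'g monoid \<times> ('g \<Rightarrow> 'g \<Rightarrow> 'g \<times> 'g) \<Rightarrow> 'g monoid \<times> ('g \<Rightarrow> 'g \<Rightarrow> 'g \<times> 'g)" where
  "RetG S = (case S of (G, \<sigma>) \<Rightarrow>
     (\<lparr>carrier = grp_rep G \<sigma> ` carrier G,
       mult = (\<lambda>a b. grp_rep G \<sigma> (a \<otimes>\<^bsub>G\<^esub> b)),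
       one = grp_rep G \<sigma> \<one>\<^bsub>G\<^esub>\<rparr>,
      \<lambda>a b. map_prod (grp_rep G \<sigma>) (grp_rep G \<sigma>) (\<sigma> a b)))"

definition mplG :: "'g monoid \<times> ('g \<Rightarrow> 'g \<Rightarrow> 'g \<times> 'g) \<Rightarrow> nat \<Rightarrow> bool" where
  "mplG S m \<longleftrightarrow> (\<exists>e. carrier (fst ((RetG ^^ m) S)) = {e}) \<and>
                 (\<forall>k<m. \<not> (\<exists>e. carrier (fst ((RetG ^^ k) S)) = {e}))"

end

theory Submission
  imports Defs "HOL-Algebra.Generated_Groups"
begin

text \<open>
  The structure group \<open>G\<close> is made into a brace. For \<open>y \<in> X\<close> the maps \<open>p \<mapsto> p \<cdot> (p\<inverse> \<cdot> y)\<close>, with \<open>p\<inverse>\<close>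
  acting on \<open>X\<close>, are commuting bijections of \<open>G\<close> which generate an abelian group acting regularly
  on \<open>G\<close>; transporting its multiplication to \<open>G\<close> gives the addition of the brace, and the brace
  yields the braiding. The braiding is unique because a group homomorphism that respects braidings
  on an invariant set of generators respects them everywhere.

  All the groups in the theorem are then images of \<open>G\<close>, so that only kernels have to be compared.
  The comparison rests on one fact: two elements that act in the same way on an invariant set of
  generators of a symmetric group act in the same way on the whole group.
\<close>

text \<open>The braiding of \<open>G\<close> is given by a definite description, so nothing can be
  computed with it before existence and uniqueness are both known. \<open>G\<close> itself is only a
  presentation, and an addition cannot be written down on words; it is therefore read off from
  permutations of \<open>G\<close>. The braid relation lets \<open>G\<close> act on
  \<open>X\<close>, non-degeneracy together with involutivity makes the translations bijective, and
  involutivity makes them commute. A separate obstacle is that \<open>Lmap\<close> pulls the action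
  back from \<open>G\<close> to \<open>X\<close>, which requires the map from \<open>X\<close> to
  \<open>G\<close> to be injective. This is shown with an action of \<open>G\<close> by affine maps
  on integer-valued functions. Retractions consist of arbitrarily chosen representatives; comparing
  kernels avoids computing with these choices.\<close>

lemma generate_subset_closed:
  assumes "u \<in> generate G Y" "\<one>\<^bsub>G\<^esub> \<in> S" "Y \<subseteq> S"
    and "\<And>y. y \<in> Y \<Longrightarrow> inv\<^bsub>G\<^esub> y \<in> S"
    and "\<And>a b. a \<in> S \<Longrightarrow> b \<in> S \<Longrightarrow> a \<otimes>\<^bsub>G\<^esub> b \<in> S"
  shows "u \<in> S"
  using assms(1) by (induction rule: generate.induct) (use assms(2-) in auto)

section \<open>Symmetric groups\<close>

locale symgrp = fixes G (structure) and \<sigma>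
  assumes symmetric: "symmetric_group G \<sigma>"
begin

abbreviation L where "L \<equiv> lact \<sigma>"
abbreviation R where "R \<equiv> ract \<sigma>"

sublocale group G
  using symmetric by (simp add: symmetric_group_def)

lemma braiding_eq: "\<sigma> a b = (L a b, R a b)"
  by (simp add: lact_def ract_def)

lemma L_closed [simp]: "a \<in> carrier G \<Longrightarrow> b \<in> carrier G \<Longrightarrow> L a b \<in> carrier G"
  using symmetric unfolding symmetric_group_def lact_def by (metis mem_Times_iff)

lemma R_closed [simp]: "a \<in> carrier G \<Longrightarrow> b \<in> carrier G \<Longrightarrow> R a b \<in> carrier G"
  using symmetric unfolding symmetric_group_def ract_def by (metis mem_Times_iff)

lemma L_one [simp]: "a \<in> carrier G \<Longrightarrow> L a \<one> = \<one>"
  and one_L [simp]: "a \<in> carrier G \<Longrightarrow> L \<one> a = a"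
  and one_R [simp]: "a \<in> carrier G \<Longrightarrow> R \<one> a = \<one>"
  and R_one [simp]: "a \<in> carrier G \<Longrightarrow> R a \<one> = a"
  using symmetric unfolding symmetric_group_def by blast+

lemma mult_L: "a \<in> carrier G \<Longrightarrow> b \<in> carrier G \<Longrightarrow> u \<in> carrier G \<Longrightarrow> L (a \<otimes> b) u = L a (L b u)"
  and R_mult: "a \<in> carrier G \<Longrightarrow> u \<in> carrier G \<Longrightarrow> v \<in> carrier G \<Longrightarrow> R a (u \<otimes> v) = R (R a u) v"
  and L_mult: "a \<in> carrier G \<Longrightarrow> u \<in> carrier G \<Longrightarrow> v \<in> carrier G \<Longrightarrow>
      L a (u \<otimes> v) = L a u \<otimes> L (R a u) v"
  and mult_R: "a \<in> carrier G \<Longrightarrow> b \<in> carrier G \<Longrightarrow> u \<in> carrier G \<Longrightarrow>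
      R (a \<otimes> b) u = R a (L b u) \<otimes> R b u"
  and mult_LR: "a \<in> carrier G \<Longrightarrow> b \<in> carrier G \<Longrightarrow> a \<otimes> b = L a b \<otimes> R a b"
  using symmetric unfolding symmetric_group_def by blast+

lemma involutive_LR:
  assumes "a \<in> carrier G" "b \<in> carrier G"
  shows "L (L a b) (R a b) = a" "R (L a b) (R a b) = b"
proof -
  have "\<sigma> (fst (\<sigma> a b)) (snd (\<sigma> a b)) = (a, b)"
    using symmetric assms unfolding symmetric_group_def by (simp add: case_prod_beta)
  then show "L (L a b) (R a b) = a" "R (L a b) (R a b) = b"
    by (simp_all add: lact_def ract_def)
qed

text \<open>The product and the left action determine the right action, so most later arguments
  treat the left action only.\<close>

lemma R_eq: "a \<in> carrier G \<Longrightarrow> b \<in> carrier G \<Longrightarrow> R a b = inv (L a b) \<otimes> (a \<otimes> b)"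
  by (metis L_closed R_closed inv_solve_left m_closed mult_LR)

lemma L_inv_L [simp]: "a \<in> carrier G \<Longrightarrow> b \<in> carrier G \<Longrightarrow> L (inv a) (L a b) = b"
  and L_L_inv [simp]: "a \<in> carrier G \<Longrightarrow> b \<in> carrier G \<Longrightarrow> L a (L (inv a) b) = b"
  by (simp_all flip: mult_L)

lemma R_inv_R [simp]: "a \<in> carrier G \<Longrightarrow> b \<in> carrier G \<Longrightarrow> R (R a b) (inv b) = a"
  and R_R_inv [simp]: "a \<in> carrier G \<Longrightarrow> b \<in> carrier G \<Longrightarrow> R (R a (inv b)) b = a"
  by (simp_all flip: R_mult)

lemma L_inv:
  assumes "a \<in> carrier G" "b \<in> carrier G"
  shows "L a (inv b) = inv (L (R a (inv b)) b)"
proof -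
  have "L a (inv b) \<otimes> L (R a (inv b)) b = \<one>"
    using assms by (simp flip: L_mult)
  with assms show ?thesis
    by (simp add: inv_equality)
qed

section \<open>Congruence modulo the socle\<close>

definition act_eq where "act_eq a b \<longleftrightarrow> (\<forall>u\<in>carrier G. L a u = L b u)"

lemma act_eq_iff_soc:
  assumes "a \<in> carrier G" "b \<in> carrier G"
  shows "act_eq a b \<longleftrightarrow> inv a \<otimes> b \<in> soc G \<sigma>"
  using assms unfolding act_eq_def soc_def
  by (simp add: mult_L) (metis L_L_inv L_closed L_inv_L)

lemma soc_conj:
  assumes s: "s \<in> soc G \<sigma>" and u: "u \<in> carrier G"
  shows "u \<otimes> s \<otimes> inv u \<in> soc G \<sigma>"
  using assms unfolding soc_def by (simp add: mult_L)

text \<open>The conjugate \<open>s'\<close> is again in the socle, so it fixes \<open>u\<close>, and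
  \<open>s' \<otimes> u = u \<otimes> s\<close> forces \<open>R s' u = s\<close>. Involutivity
  applied to the pair \<open>s'\<close>, \<open>u\<close> then yields the claim.\<close>

lemma L_soc:
  assumes s: "s \<in> soc G \<sigma>" and u: "u \<in> carrier G"
  shows "L u s = u \<otimes> s \<otimes> inv u"
proof -
  define s' where "s' = u \<otimes> s \<otimes> inv u"
  have s': "s' \<in> carrier G" "L s' u = u" and sc: "s \<in> carrier G"
    using soc_conj[OF s u] s u by (auto simp: s'_def soc_def)
  have "R s' u = s"
  proof -
    have "s' \<otimes> u = u \<otimes> s" using u sc by (simp add: s'_def m_assoc)
    then show ?thesis using s' u sc by (simp add: R_eq flip: m_assoc)
  qed
  then show ?thesis
    using involutive_LR(1)[OF s'(1) u] s' by (simp add: s'_def)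
qed

text \<open>With \<open>b' = b \<otimes> s\<close> and \<open>s\<close> in the socle,
  \<open>L a' b'\<close> differs from \<open>L a b\<close> by the factor \<open>L (R a b) s\<close>,
  which is a conjugate of \<open>s\<close> by \<open>L_soc\<close> and hence in the socle.\<close>

lemma act_eq_L:
  assumes "a \<in> carrier G" "a' \<in> carrier G" "b \<in> carrier G" "b' \<in> carrier G"
    and "act_eq a a'" "act_eq b b'"
  shows "act_eq (L a b) (L a' b')"
proof -
  define s where "s = inv b \<otimes> b'"
  have s: "s \<in> soc G \<sigma>" and sc: "s \<in> carrier G"
    using assms act_eq_iff_soc by (auto simp: s_def)
  have b': "b' = b \<otimes> s" using assms by (simp add: s_def flip: m_assoc)
  have "L a' b' = L a b'"
    using assms by (simp add: act_eq_def)
  then have "L a' b' = L a b \<otimes> L (R a b) s"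
    using assms sc by (simp add: b' L_mult)
  moreover have "L (R a b) s \<in> soc G \<sigma>"
    using s assms by (simp add: L_soc soc_conj)
  moreover have "inv (L a b) \<otimes> (L a b \<otimes> L (R a b) s) = L (R a b) s"
    using assms sc by (simp flip: m_assoc)
  ultimately have "inv (L a b) \<otimes> L a' b' \<in> soc G \<sigma>"
    by simp
  then show ?thesis
    using assms by (simp only: act_eq_iff_soc L_closed)
qed

lemma act_eq_inv:
  assumes "a \<in> carrier G" "b \<in> carrier G" "act_eq a b"
  shows "act_eq (inv a) (inv b)"
proof -
  have "L (inv a) u = L (inv b) u" if u: "u \<in> carrier G" for u
  proof -
    have "L (inv a) u = L (inv a) (L b (L (inv b) u))" using assms u by simp
    also have "\<dots> = L (inv a) (L a (L (inv b) u))" using assms u by (simp add: act_eq_def)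
    also have "\<dots> = L (inv b) u" using assms u by simp
    finally show ?thesis .
  qed
  then show ?thesis by (simp add: act_eq_def)
qed

lemma act_eq_mult:
  assumes "a \<in> carrier G" "a' \<in> carrier G" "b \<in> carrier G" "b' \<in> carrier G"
    and "act_eq a a'" "act_eq b b'"
  shows "act_eq (a \<otimes> b) (a' \<otimes> b')"
  using assms unfolding act_eq_def by (simp add: mult_L)

lemma act_eq_R:
  assumes "a \<in> carrier G" "a' \<in> carrier G" "b \<in> carrier G" "b' \<in> carrier G"
    and "act_eq a a'" "act_eq b b'"
  shows "act_eq (R a b) (R a' b')"
  using assms by (simp add: R_eq act_eq_mult act_eq_inv act_eq_L)

text \<open>The elements acting trivially on \<open>Y\<close> form a normal subgroup \<open>K\<close>, because \<open>Y\<close> is invariant.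
  If \<open>K\<close> fixes \<open>u\<close>, then \<open>\<lambda>k. R k u\<close> is conjugation by \<open>u\<inverse>\<close> on \<open>K\<close>, hence maps \<open>K\<close> onto itself; so the
  elements fixed by \<open>K\<close> form a subgroup.\<close>
lemma act_trivial_from_generators:
  assumes Y: "Y \<subseteq> carrier G" and gen: "generate G Y = carrier G"
    and inv_Y: "\<And>a y. a \<in> carrier G \<Longrightarrow> y \<in> Y \<Longrightarrow> L a y \<in> Y"
    and a: "a \<in> carrier G" "\<And>y. y \<in> Y \<Longrightarrow> L a y = y"
    and u: "u \<in> carrier G"
  shows "L a u = u"
proof -
  define K where "K = {a \<in> carrier G. \<forall>y\<in>Y. L a y = y}"
  have conj: "v \<otimes> k \<otimes> inv v \<in> K" if "k \<in> K" "v \<in> carrier G" for k v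
    using that Y inv_Y by (auto simp: K_def mult_L subset_iff)
  have conj': "inv v \<otimes> (k \<otimes> v) \<in> K" if "k \<in> K" "v \<in> carrier G" for k v
    using conj[OF that(1), of "inv v"] that by (simp add: K_def m_assoc)
  have R_K: "R k v = inv v \<otimes> (k \<otimes> v)" if "k \<in> K" "v \<in> carrier G" "L k v = v" for k v
    using that by (simp add: R_eq K_def)
  define S where "S = {u \<in> carrier G. \<forall>k\<in>K. L k u = u}"
  have KC: "k \<in> carrier G" if "k \<in> K" for k using that by (simp add: K_def)
  have "u \<in> S"
  proof (rule generate_subset_closed[of u G Y])
    show "u \<in> generate G Y" using u gen by simp
    show "\<one> \<in> S" using KC by (simp add: S_def)
    show YS: "Y \<subseteq> S" using Y by (auto simp: S_def K_def)
    show "inv y \<in> S" if "y \<in> Y" for y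
    proof -
      have y: "y \<in> carrier G" using that Y by auto
      have "L k (inv y) = inv y" if k: "k \<in> K" for k
      proof -
        \<comment> \<open>Chosen so that \<open>R k' y = k\<close>, that is
          \<open>R k (inv y) = k'\<close>; then \<open>L_inv\<close> reduces the goal to
          \<open>L k' y = y\<close>.\<close>
        define k' where "k' = y \<otimes> k \<otimes> inv y"
        have k': "k' \<in> K" using conj k y by (simp add: k'_def)
        have Lk': "L k' y = y" using k' YS \<open>y \<in> Y\<close> by (auto simp: S_def)
        have "R k' y = k"
          using R_K[OF k' y Lk'] y KC[OF k] by (simp add: k'_def m_assoc) (simp flip: m_assoc)
        then have "R k (inv y) = k'" using y KC[OF k'] by auto
        then show ?thesis using y KC[OF k] Lk' by (simp add: L_inv)
      qed
      then show ?thesis using y by (simp add: S_def)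
    qed
    show "b \<otimes> c \<in> S" if "b \<in> S" "c \<in> S" for b c
    proof -
      have "L k (b \<otimes> c) = b \<otimes> c" if k: "k \<in> K" for k
      proof -
        have "R k b \<in> K" using R_K[OF k, of b] conj'[OF k, of b] \<open>b \<in> S\<close> k by (simp add: S_def)
        then show ?thesis using \<open>b \<in> S\<close> \<open>c \<in> S\<close> k KC[OF k] by (simp add: S_def L_mult)
      qed
      then show ?thesis using that by (simp add: S_def)
    qed
  qed
  then show ?thesis using a by (simp add: S_def K_def)
qed

lemma act_eq_from_generators:
  assumes Y: "Y \<subseteq> carrier G" and gen: "generate G Y = carrier G"
    and inv_Y: "\<And>a y. a \<in> carrier G \<Longrightarrow> y \<in> Y \<Longrightarrow> L a y \<in> Y"
    and a: "a \<in> carrier G" "b \<in> carrier G"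
  shows "act_eq a b \<longleftrightarrow> (\<forall>y\<in>Y. L a y = L b y)"
proof
  assume "\<forall>y\<in>Y. L a y = L b y"
  then have "L (inv a \<otimes> b) y = y" if "y \<in> Y" for y
    using that Y a by (metis L_inv_L inv_closed mult_L subset_iff)
  then have "inv a \<otimes> b \<in> soc G \<sigma>"
    using act_trivial_from_generators[OF Y gen inv_Y] a by (simp add: soc_def)
  then show "act_eq a b" using a by (simp add: act_eq_iff_soc)
qed (use Y in \<open>auto simp: act_eq_def\<close>)

end

section \<open>Morphisms of symmetric groups\<close>

text \<open>The first argument is extended from \<open>Y\<close> to \<open>G\<close> while the
  second stays in \<open>Y\<close>; then the second is extended with the first arbitrary. The
  invariance of \<open>Y\<close> is an equality, not an inclusion, because inverses of generators
  must act on \<open>Y\<close> too. Right actions follow by \<open>R_eq\<close>.\<close>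

lemma hom_braiding_from_generators:
  assumes G: "symmetric_group G \<sigma>" and H: "symmetric_group H \<tau>" and f: "f \<in> hom G H"
    and Y: "Y \<subseteq> carrier G" and gen: "generate G Y = carrier G"
    and bij: "\<And>y. y \<in> Y \<Longrightarrow> lact \<sigma> y ` Y = Y"
    and fY: "\<And>y z. y \<in> Y \<Longrightarrow> z \<in> Y \<Longrightarrow> f (lact \<sigma> y z) = lact \<tau> (f y) (f z)"
    and a: "a \<in> carrier G" and b: "b \<in> carrier G"
  shows "\<tau> (f a) (f b) = map_prod f f (\<sigma> a b)"
proof -
  interpret G: symgrp G \<sigma> by (standard) (rule G)
  interpret H: symgrp H \<tau> by (standard) (rule H)
  interpret f: group_hom G H f by (standard) (rule f)
  note YG = subsetD[OF Y]
  \<comment> \<open>The clause on the image of \<open>Y\<close> keeps \<open>G.L c z\<close> in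
    \<open>Y\<close>, as the step for products requires.\<close>
  define S where "S = {a \<in> carrier G. G.L a ` Y = Y \<and> (\<forall>z\<in>Y. f (G.L a z) = H.L (f a) (f z))}"
  have aS: "a \<in> S" if "a \<in> carrier G" for a
  proof (rule generate_subset_closed[of a G Y])
    show "a \<in> generate G Y" using that gen by simp
    show "\<one>\<^bsub>G\<^esub> \<in> S" using YG by (auto simp: S_def image_def)
    show YS: "Y \<subseteq> S" using bij fY YG by (auto simp: S_def)
    show "inv\<^bsub>G\<^esub> y \<in> S" if y: "y \<in> Y" for y
    proof -
      have "f (G.L (inv\<^bsub>G\<^esub> y) z) = H.L (f (inv\<^bsub>G\<^esub> y)) (f z) \<and> G.L (inv\<^bsub>G\<^esub> y) z \<in> Y" if z: "z \<in> Y" for z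
      proof -
        obtain w where w: "w \<in> Y" "z = G.L y w" using bij[OF y] z by blast
        then show ?thesis using fY[OF y w(1)] YG y by simp
      qed
      moreover have "Y \<subseteq> G.L (inv\<^bsub>G\<^esub> y) ` Y"
      proof
        fix z assume z: "z \<in> Y"
        then have "G.L y z \<in> Y" "z = G.L (inv\<^bsub>G\<^esub> y) (G.L y z)"
          using bij[OF y] YG[OF y] YG[OF z] by auto
        then show "z \<in> G.L (inv\<^bsub>G\<^esub> y) ` Y" by blast
      qed
      ultimately show ?thesis using YG[OF y] unfolding S_def by blast
    qed
    show "b \<otimes>\<^bsub>G\<^esub> c \<in> S" if "b \<in> S" "c \<in> S" for b c
    proof -
      have bc: "b \<in> carrier G" "c \<in> carrier G" "G.L c ` Y = Y" "G.L b ` Y = Y"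
        using that by (auto simp: S_def)
      have *: "G.L (b \<otimes>\<^bsub>G\<^esub> c) z = G.L b (G.L c z)" if "z \<in> Y" for z
        using that YG bc by (simp add: G.mult_L)
      have "G.L (b \<otimes>\<^bsub>G\<^esub> c) ` Y = G.L b ` G.L c ` Y"
        using * by (auto simp: image_image)
      moreover have "f (G.L (b \<otimes>\<^bsub>G\<^esub> c) z) = H.L (f (b \<otimes>\<^bsub>G\<^esub> c)) (f z)" if z: "z \<in> Y" for z
      proof -
        have "G.L c z \<in> Y" using bc z by blast
        then show ?thesis
          using \<open>b \<in> S\<close> \<open>c \<in> S\<close> z bc YG[OF z] by (simp add: * S_def H.mult_L)
      qed
      ultimately show ?thesis using bc by (simp add: S_def)
    qed
  qed
  have R_from_L: "f (G.R a b) = H.R (f a) (f b)"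
    if "a \<in> carrier G" "b \<in> carrier G" "f (G.L a b) = H.L (f a) (f b)" for a b
    using that by (simp add: G.R_eq H.R_eq)
  define T where "T = {b \<in> carrier G. \<forall>a\<in>carrier G. f (G.L a b) = H.L (f a) (f b)}"
  have "b \<in> T"
  proof (rule generate_subset_closed[of b G Y])
    show "b \<in> generate G Y" using b gen by simp
    show "\<one>\<^bsub>G\<^esub> \<in> T" by (simp add: T_def)
    show YT: "Y \<subseteq> T" using aS YG by (auto simp: T_def S_def)
    show "inv\<^bsub>G\<^esub> y \<in> T" if y: "y \<in> Y" for y
    proof -
      have yG: "y \<in> carrier G" by (rule YG[OF y])
      have "f (G.L a (inv\<^bsub>G\<^esub> y)) = H.L (f a) (f (inv\<^bsub>G\<^esub> y))" if a: "a \<in> carrier G" for a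
      proof -
        \<comment> \<open>\<open>L_inv\<close> expresses the action on \<open>inv y\<close> through
          \<open>G.L a' y\<close>, so it remains to see that \<open>f\<close> takes
          \<open>a'\<close> to the corresponding element of \<open>H\<close>.\<close>
        define a' where "a' = G.R a (inv\<^bsub>G\<^esub> y)"
        have a': "a' \<in> carrier G" "G.R a' y = a" using a yG by (simp_all add: a'_def)
        have La': "f (G.L a' y) = H.L (f a') (f y)" using YT y a' by (auto simp: T_def)
        have "H.R (f a') (f y) = f a" using R_from_L[OF a'(1) yG La'] a' by simp
        then have "f a' = H.R (f a) (inv\<^bsub>H\<^esub> f y)" using a' yG by (metis H.R_inv_R f.hom_closed)
        then show ?thesis using a yG a' La' by (simp add: G.L_inv H.L_inv flip: a'_def)
      qed
      then show ?thesis using yG by (simp add: T_def)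
    qed
    show "b \<otimes>\<^bsub>G\<^esub> c \<in> T" if "b \<in> T" "c \<in> T" for b c
      using that R_from_L by (simp add: T_def G.L_mult H.L_mult)
  qed
  then have "f (G.L a b) = H.L (f a) (f b)" using a by (simp add: T_def)
  then show ?thesis using R_from_L[OF a b] by (simp add: G.braiding_eq H.braiding_eq)
qed

text \<open>The target is not assumed to be a group, so preservation of the unit is demanded
  explicitly. This allows the axioms themselves to be transported along \<open>f\<close>.\<close>

definition sym_epi :: "('g \<Rightarrow> 'h) \<Rightarrow> 'g monoid \<times> ('g \<Rightarrow> 'g \<Rightarrow> 'g \<times> 'g) \<Rightarrow>
    'h monoid \<times> ('h \<Rightarrow> 'h \<Rightarrow> 'h \<times> 'h) \<Rightarrow> bool" where
  "sym_epi f S T \<longleftrightarrow> f ` carrier (fst S) = carrier (fst T) \<and> f \<one>\<^bsub>fst S\<^esub> = \<one>\<^bsub>fst T\<^esub> \<and>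
     (\<forall>a\<in>carrier (fst S). \<forall>b\<in>carrier (fst S).
        f (a \<otimes>\<^bsub>fst S\<^esub> b) = f a \<otimes>\<^bsub>fst T\<^esub> f b \<and> snd T (f a) (f b) = map_prod f f (snd S a b))"

abbreviation symgroup where "symgroup S \<equiv> symmetric_group (fst S) (snd S)"

lemma sym_epiD:
  assumes "sym_epi f S T" "a \<in> carrier (fst S)" "b \<in> carrier (fst S)"
  shows "f a \<in> carrier (fst T)" "f (a \<otimes>\<^bsub>fst S\<^esub> b) = f a \<otimes>\<^bsub>fst T\<^esub> f b"
    "f (lact (snd S) a b) = lact (snd T) (f a) (f b)"
    "f (ract (snd S) a b) = ract (snd T) (f a) (f b)"
  using assms by (auto simp: sym_epi_def lact_def ract_def)

text \<open>The equational axioms and the existence of inverses pass to images; bijectivity of the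
  braiding is recovered from involutivity.\<close>

lemma sym_epi_symgroup:
  assumes "symgroup S" "sym_epi f S T"
  shows "symgroup T"
proof -
  obtain G \<sigma> H \<tau> where ST: "S = (G, \<sigma>)" "T = (H, \<tau>)" by (metis surj_pair)
  interpret G: symgrp G \<sigma> using assms ST by unfold_locales simp
  note f = sym_epiD[OF assms(2), unfolded ST fst_conv snd_conv]
  have im: "f ` carrier G = carrier H" and one: "\<one>\<^bsub>H\<^esub> = f \<one>\<^bsub>G\<^esub>"
    using assms(2) by (auto simp: ST sym_epi_def)
  have \<tau>: "\<tau> (f a) (f b) = (f (G.L a b), f (G.R a b))" if "a \<in> carrier G" "b \<in> carrier G" for a b
    using assms(2) that by (auto simp: ST sym_epi_def G.braiding_eq)
  have ball: "(\<forall>a\<in>carrier H. P a) \<longleftrightarrow> (\<forall>a\<in>carrier G. P (f a))" for P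
    unfolding im[symmetric] by auto
  have "group H"
  proof (rule groupI)
    show "\<one>\<^bsub>H\<^esub> \<in> carrier H" using im by (auto simp: one)
    show "x \<otimes>\<^bsub>H\<^esub> y \<in> carrier H" if "x \<in> carrier H" "y \<in> carrier H" for x y
      using that unfolding im[symmetric] by (auto simp flip: f(2))
    show "x \<otimes>\<^bsub>H\<^esub> y \<otimes>\<^bsub>H\<^esub> z = x \<otimes>\<^bsub>H\<^esub> (y \<otimes>\<^bsub>H\<^esub> z)"
      if "x \<in> carrier H" "y \<in> carrier H" "z \<in> carrier H" for x y z
      using that unfolding im[symmetric] by (auto simp: G.m_assoc simp flip: f(2))
    show "\<one>\<^bsub>H\<^esub> \<otimes>\<^bsub>H\<^esub> x = x" if "x \<in> carrier H" for x
      using that unfolding im[symmetric] one by (auto simp flip: f(2))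
    show "\<exists>y\<in>carrier H. y \<otimes>\<^bsub>H\<^esub> x = \<one>\<^bsub>H\<^esub>" if "x \<in> carrier H" for x
      using that unfolding im[symmetric] one by (auto simp flip: f(2) intro!: bexI[of _ "inv\<^bsub>G\<^esub> _"])
  qed
  moreover have closed: "\<tau> a b \<in> carrier H \<times> carrier H" if "a \<in> carrier H" "b \<in> carrier H" for a b
    using that unfolding im[symmetric] by (auto simp: \<tau>)
  moreover have invol: "(\<lambda>(u, v). \<tau> u v) (\<tau> a b) = (a, b)" if "a \<in> carrier H" "b \<in> carrier H" for a b
    using that unfolding im[symmetric] by (auto simp: \<tau> G.involutive_LR)
  moreover have "bij_betw (\<lambda>(a, b). \<tau> a b) (carrier H \<times> carrier H) (carrier H \<times> carrier H)"
    by (rule bij_betw_byWitness[where f' = "\<lambda>(a, b). \<tau> a b"])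
       (use closed invol in \<open>fastforce+\<close>)
  ultimately show ?thesis
    unfolding ST fst_conv snd_conv symmetric_group_def
    by (simp add: ball one G.mult_L G.L_mult G.R_mult G.mult_R f(1) flip: f(2-4))
       (simp add: f(2) flip: f(3,4), metis G.L_closed G.R_closed G.mult_LR f(2))
qed

lemma sym_epi_comp:
  assumes "sym_epi f S T" "sym_epi g T U"
  shows "sym_epi (g \<circ> f) S U"
proof -
  have "f a \<in> carrier (fst T)" if "a \<in> carrier (fst S)" for a
    using assms(1) that by (auto simp: sym_epi_def)
  moreover have "(g \<circ> f) ` carrier (fst S) = carrier (fst U)"
    using assms unfolding sym_epi_def image_comp[symmetric] by simp
  ultimately show ?thesis
    using assms by (simp add: sym_epi_def map_prod.compositionality)
qed

text \<open>Sending \<open>f a\<close> to \<open>g a\<close> is well defined and injective by the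
  kernel condition. Every isomorphism below is obtained in this way.\<close>

lemma sym_iso_same_kernel:
  assumes S: "symgroup S" and f: "sym_epi f S T" and g: "sym_epi g S U"
    and ker: "\<And>a b. a \<in> carrier (fst S) \<Longrightarrow> b \<in> carrier (fst S) \<Longrightarrow> f a = f b \<longleftrightarrow> g a = g b"
  shows "sym_iso T U"
proof -
  interpret S: symgrp "fst S" "snd S" using S by unfold_locales
  define h where "h = (\<lambda>t. g (SOME a. a \<in> carrier (fst S) \<and> f a = t))"
  have h: "h (f a) = g a" if "a \<in> carrier (fst S)" for a
  proof -
    have "(SOME b. b \<in> carrier (fst S) \<and> f b = f a) \<in> carrier (fst S) \<and>
      f (SOME b. b \<in> carrier (fst S) \<and> f b = f a) = f a"
      by (rule someI[of "\<lambda>b. b \<in> carrier (fst S) \<and> f b = f a"]) (use that in auto)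
    then show ?thesis using that ker by (auto simp: h_def)
  qed
  have imf: "carrier (fst T) = f ` carrier (fst S)" and img: "carrier (fst U) = g ` carrier (fst S)"
    using f g by (auto simp: sym_epi_def)
  have "h \<in> hom (fst T) (fst U)"
    unfolding hom_def by (auto simp: imf img h simp flip: sym_epiD(2)[OF f] sym_epiD(2)[OF g])
  moreover have "bij_betw h (carrier (fst T)) (carrier (fst U))"
    unfolding bij_betw_def inj_on_def by (auto simp: imf img h ker image_image)
  moreover have "snd U (h a) (h b) = map_prod h h (snd T a b)"
    if ab: "a \<in> carrier (fst T)" "b \<in> carrier (fst T)" for a b
  proof -
    obtain x where x: "a = f x" "x \<in> carrier (fst S)"
      using ab(1) unfolding imf by blast
    obtain y where y: "b = f y" "y \<in> carrier (fst S)"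
      using ab(2) unfolding imf by blast
    note xy = x y
    have "snd T (f x) (f y) = map_prod f f (snd S x y)" "snd U (g x) (g y) = map_prod g g (snd S x y)"
      using f g xy by (simp_all add: sym_epi_def)
    then show ?thesis using xy by (simp add: h S.braiding_eq)
  qed
  ultimately show ?thesis unfolding sym_iso_def iso_def by blast
qed

lemma sym_iso_imp_sym_epi:
  assumes "symgroup S" "symgroup T" "sym_iso S T"
  obtains f where "sym_epi f S T" "inj_on f (carrier (fst S))"
proof -
  obtain f where f: "f \<in> iso (fst S) (fst T)"
    "\<forall>a\<in>carrier (fst S). \<forall>b\<in>carrier (fst S). snd T (f a) (f b) = map_prod f f (snd S a b)"
    using assms(3) by (auto simp: sym_iso_def)
  interpret f: group_hom "fst S" "fst T" f
    using assms f(1) by (simp add: group_hom_def group_hom_axioms_def symmetric_group_def iso_def)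
  have "sym_epi f S T"
    using f f.hom_one by (auto simp: sym_epi_def iso_def bij_betw_def hom_def)
  then show ?thesis
    using f(1) that by (auto simp: iso_def bij_betw_def)
qed

section \<open>Retraction of symmetric groups\<close>

context symgrp
begin

lemma mem_soc_coset:
  assumes "a \<in> carrier G"
  shows "b \<in> soc G \<sigma> #> a \<longleftrightarrow> b \<in> carrier G \<and> act_eq b a"
proof
  assume "b \<in> soc G \<sigma> #> a"
  then show "b \<in> carrier G \<and> act_eq b a"
    using assms by (auto simp: r_coset_def soc_def act_eq_def mult_L)
next
  assume b: "b \<in> carrier G \<and> act_eq b a"
  then have "b \<otimes> inv a \<in> soc G \<sigma>"
    using assms by (auto simp: soc_def act_eq_def mult_L)
  moreover have "b = (b \<otimes> inv a) \<otimes> a" using assms b by (simp add: m_assoc)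
  ultimately show "b \<in> soc G \<sigma> #> a" unfolding r_coset_def by blast
qed

lemma act_eq_sym: "act_eq a b \<longleftrightarrow> act_eq b a"
  by (auto simp: act_eq_def)

lemma grp_rep:
  assumes "a \<in> carrier G"
  shows "grp_rep G \<sigma> a \<in> carrier G" "act_eq (grp_rep G \<sigma> a) a"
proof -
  have "grp_rep G \<sigma> a \<in> soc G \<sigma> #> a"
    unfolding grp_rep_def by (rule someI[of _ a]) (simp add: mem_soc_coset assms act_eq_def)
  then show "grp_rep G \<sigma> a \<in> carrier G" "act_eq (grp_rep G \<sigma> a) a"
    using assms by (simp_all add: mem_soc_coset)
qed

lemma grp_rep_eq_iff:
  assumes "a \<in> carrier G" "b \<in> carrier G"
  shows "grp_rep G \<sigma> a = grp_rep G \<sigma> b \<longleftrightarrow> act_eq a b"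
proof
  assume "grp_rep G \<sigma> a = grp_rep G \<sigma> b"
  then show "act_eq a b" using grp_rep[OF assms(1)] grp_rep[OF assms(2)] by (simp add: act_eq_def)
next
  assume "act_eq a b"
  then have "soc G \<sigma> #> a = soc G \<sigma> #> b"
    using assms by (auto simp: mem_soc_coset act_eq_def)
  then show "grp_rep G \<sigma> a = grp_rep G \<sigma> b" by (simp add: grp_rep_def)
qed

end

lemma sym_epi_RetG:
  assumes "symgroup S"
  shows "sym_epi (grp_rep (fst S) (snd S)) S (RetG S)"
proof -
  interpret S: symgrp "fst S" "snd S" using assms by unfold_locales
  show ?thesis
    unfolding sym_epi_def RetG_def case_prod_beta fst_conv snd_conv
    by (auto simp: S.grp_rep_eq_iff S.grp_rep S.braiding_eq S.act_eq_sym[of _ "grp_rep _ _ _"]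
        intro!: S.act_eq_mult S.act_eq_L S.act_eq_R)
qed

lemma symgroup_RetG: "symgroup S \<Longrightarrow> symgroup (RetG S)"
  by (rule sym_epi_symgroup[OF _ sym_epi_RetG])

lemma symgroup_RetG_funpow: "symgroup S \<Longrightarrow> symgroup ((RetG ^^ k) S)"
  by (induction k) (simp_all add: symgroup_RetG)

text \<open>Describes the kernel of \<open>S\<close> mapping onto \<open>RetG T\<close> inside
  \<open>S\<close>: surjectivity of \<open>f\<close> lets the test elements of \<open>T\<close> be
  taken as images.\<close>

lemma grp_rep_sym_epi_eq_iff:
  assumes S: "symgroup S" and f: "sym_epi f S T" and "a \<in> carrier (fst S)" "b \<in> carrier (fst S)"
  shows "grp_rep (fst T) (snd T) (f a) = grp_rep (fst T) (snd T) (f b) \<longleftrightarrow>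
    (\<forall>u\<in>carrier (fst S). f (lact (snd S) a u) = f (lact (snd S) b u))"
proof -
  interpret T: symgrp "fst T" "snd T" using sym_epi_symgroup[OF S f] by unfold_locales
  have im: "f ` carrier (fst S) = carrier (fst T)" using f by (simp add: sym_epi_def)
  show ?thesis
    using assms sym_epiD(1,3)[OF f] by (simp add: T.grp_rep_eq_iff T.act_eq_def flip: im)
qed

lemma sym_iso_RetG:
  assumes S: "symgroup S" and T: "symgroup T" and iso: "sym_iso S T"
  shows "sym_iso (RetG S) (RetG T)"
proof -
  interpret S: symgrp "fst S" "snd S" using S by unfold_locales
  obtain f where f: "sym_epi f S T" "inj_on f (carrier (fst S))"
    using sym_iso_imp_sym_epi[OF assms] .
  show ?thesis
  proof (rule sym_iso_same_kernel[OF S sym_epi_RetG[OF S] sym_epi_comp[OF f(1) sym_epi_RetG[OF T]]])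
    fix a b assume ab: "a \<in> carrier (fst S)" "b \<in> carrier (fst S)"
    show "grp_rep (fst S) (snd S) a = grp_rep (fst S) (snd S) b \<longleftrightarrow>
      (grp_rep (fst T) (snd T) \<circ> f) a = (grp_rep (fst T) (snd T) \<circ> f) b"
      using ab f(2) by (simp add: S.grp_rep_eq_iff grp_rep_sym_epi_eq_iff[OF S f(1)] S.act_eq_def inj_on_eq_iff)
  qed
qed

lemma sym_iso_trans:
  assumes S: "symgroup S" and T: "symgroup T" and U: "symgroup U"
    and "sym_iso S T" "sym_iso T U"
  shows "sym_iso S U"
proof -
  interpret S: symgrp "fst S" "snd S" using S by unfold_locales
  obtain f where f: "sym_epi f S T" "inj_on f (carrier (fst S))"
    using sym_iso_imp_sym_epi[OF S T assms(4)] .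
  obtain g where g: "sym_epi g T U" "inj_on g (carrier (fst T))"
    using sym_iso_imp_sym_epi[OF T U assms(5)] .
  have id: "sym_epi id S S" by (simp add: sym_epi_def map_prod.id)
  show ?thesis
    by (rule sym_iso_same_kernel[OF S id sym_epi_comp[OF f(1) g(1)]])
       (use f g sym_epiD(1)[OF f(1)] in \<open>simp add: inj_on_eq_iff\<close>)
qed

lemma sym_iso_RetG_funpow:
  assumes "symgroup S" "symgroup T" "sym_iso S T"
  shows "sym_iso ((RetG ^^ k) S) ((RetG ^^ k) T)"
  using assms by (induction k) (simp_all add: sym_iso_RetG symgroup_RetG_funpow)

lemma sym_iso_singleton:
  assumes "sym_iso S T"
  shows "(\<exists>e. carrier (fst S) = {e}) \<longleftrightarrow> (\<exists>e. carrier (fst T) = {e})"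
proof -
  obtain f where "bij_betw f (carrier (fst S)) (carrier (fst T))"
    using assms by (auto simp: sym_iso_def iso_def)
  then have "card (carrier (fst S)) = card (carrier (fst T))" by (rule bij_betw_same_card)
  then show ?thesis by (metis card_1_singleton_iff)
qed

section \<open>The structure group\<close>

lemma words_append [simp]: "u @ v \<in> words X \<longleftrightarrow> u \<in> words X \<and> v \<in> words X"
  and words_Nil [simp]: "[] \<in> words X"
  and words_Cons [simp]: "p # u \<in> words X \<longleftrightarrow> fst p \<in> X \<and> u \<in> words X"
  by (auto simp: words_def)

locale symset =
  fixes X :: "'a set" and r :: "'a \<Rightarrow> 'a \<Rightarrow> 'a \<times> 'a"
  assumes symset: "symmetric_set X r"
begin

abbreviation l where "l x y \<equiv> fst (r x y)"
abbreviation \<rho> where "\<rho> x y \<equiv> snd (r x y)"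

lemma l_bij: "x \<in> X \<Longrightarrow> bij_betw (l x) X X"
  and \<rho>_bij: "x \<in> X \<Longrightarrow> bij_betw (\<lambda>y. \<rho> y x) X X"
  using symset by (auto simp: symmetric_set_def)

lemma l_closed [simp]: "x \<in> X \<Longrightarrow> y \<in> X \<Longrightarrow> l x y \<in> X"
  and \<rho>_closed [simp]: "x \<in> X \<Longrightarrow> y \<in> X \<Longrightarrow> \<rho> x y \<in> X"
  using l_bij \<rho>_bij by (auto dest: bij_betwE)

lemma r_invol [simp]: "x \<in> X \<Longrightarrow> y \<in> X \<Longrightarrow> r (l x y) (\<rho> x y) = (x, y)"
  using symset by (simp add: symmetric_set_def case_prod_beta)

lemma l_comp:
  assumes "x \<in> X" "y \<in> X" "z \<in> X"
  shows "l (l x y) (l (\<rho> x y) z) = l x (l y z)"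
proof -
  have "r12 r (r23 r (r12 r (x, y, z))) = r23 r (r12 r (r23 r (x, y, z)))"
    using symset assms unfolding symmetric_set_def by blast
  then show ?thesis by (simp add: r12_def r23_def case_prod_beta)
qed

lemma weq_words: "weq X r u v \<Longrightarrow> u \<in> words X \<and> v \<in> words X"
  by (induction rule: weq.induct) auto

lemma weq_context:
  assumes "weq X r u v" "p \<in> words X" "s \<in> words X"
  shows "weq X r (p @ u @ s) (p @ v @ s)"
  using assms
proof (induction rule: weq.induct)
  case (weq_refl w)
  then show ?case by (simp add: weq.weq_refl)
next
  case (weq_sym u v)
  then show ?case by (blast intro: weq.weq_sym)
next
  case (weq_trans u v w)
  then show ?case by (blast intro: weq.weq_trans)
next
  case (weq_cancel u v x b)
  then show ?case using weq.weq_cancel[of "p @ u" X "v @ s" x r b] by simp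
next
  case (weq_rel u v x y)
  then show ?case using weq.weq_rel[of "p @ u" X "v @ s" x y r] by simp
qed

lemma weq_append:
  assumes "weq X r u u'" "weq X r v v'"
  shows "weq X r (u @ v) (u' @ v')"
proof (rule weq_trans)
  show "weq X r (u @ v) (u' @ v)"
    using weq_context[OF assms(1), of "[]" v] weq_words[OF assms(2)] by simp
  show "weq X r (u' @ v) (u' @ v')"
    using weq_context[OF assms(2), of u' "[]"] weq_words[OF assms(1)] by simp
qed

abbreviation G where "G \<equiv> struct_group X r"
abbreviation W where "W \<equiv> wclass X r"
abbreviation e where "e \<equiv> emb X r"

lemma W_eq_iff: "u \<in> words X \<Longrightarrow> v \<in> words X \<Longrightarrow> W u = W v \<longleftrightarrow> weq X r u v"
  unfolding wclass_def by (blast intro: weq.intros)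

lemma weq_SOME: "u \<in> words X \<Longrightarrow> weq X r u (SOME v. v \<in> W u)"
  using someI[of "\<lambda>v. v \<in> W u" u] by (simp add: wclass_def weq_refl)

lemma carrier_G: "carrier G = W ` words X"
  and one_G: "\<one>\<^bsub>G\<^esub> = W []"
  by (simp_all add: struct_group_def)

lemma mult_G:
  assumes "u \<in> words X" "v \<in> words X"
  shows "W u \<otimes>\<^bsub>G\<^esub> W v = W (u @ v)"
proof -
  have *: "weq X r (u @ v) ((SOME w. w \<in> W u) @ (SOME w. w \<in> W v))"
    using assms by (intro weq_append weq_SOME)
  then have "W (u @ v) = W ((SOME w. w \<in> W u) @ (SOME w. w \<in> W v))"
    using weq_words[OF *] by (simp only: W_eq_iff)
  then show ?thesis by (simp add: struct_group_def)
qed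

lemma W_closed [simp]: "u \<in> words X \<Longrightarrow> W u \<in> carrier G"
  by (simp add: carrier_G)

lemma e_closed [simp]: "x \<in> X \<Longrightarrow> e x \<in> carrier G"
  by (simp add: emb_def)

lemma W_cancel: "u \<in> words X \<Longrightarrow> x \<in> X \<Longrightarrow> W ((x, b) # (x, \<not> b) # u) = W u"
  using weq_cancel[of "[]" X u x r b] by (simp add: W_eq_iff)

lemma left_inverse:
  assumes "u \<in> words X"
  shows "\<exists>v\<in>words X. W (v @ u) = W []"
  using assms
proof (induction u)
  case Nil
  then show ?case by (auto intro: bexI[of _ "[]"])
next
  case (Cons p u)
  then obtain v where v: "v \<in> words X" "W (v @ u) = W []" by auto
  obtain x b where p: "p = (x, b)" by (cases p)
  have "weq X r (v @ [(x, \<not> b), (x, \<not> \<not> b)] @ u) (v @ u)"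
    using v Cons.prems p by (intro weq_cancel) auto
  then have "W ((v @ [(x, \<not> b)]) @ p # u) = W []"
    using v Cons.prems p by (simp flip: W_eq_iff)
  then show ?case using v Cons.prems p by (intro bexI[of _ "v @ [(x, \<not> b)]"]) auto
qed

sublocale G: group G
proof (rule groupI)
  show "x \<otimes>\<^bsub>G\<^esub> y \<in> carrier G" if "x \<in> carrier G" "y \<in> carrier G" for x y
    using that by (auto simp: carrier_G mult_G)
  show "\<one>\<^bsub>G\<^esub> \<in> carrier G" by (simp add: one_G)
  show "x \<otimes>\<^bsub>G\<^esub> y \<otimes>\<^bsub>G\<^esub> z = x \<otimes>\<^bsub>G\<^esub> (y \<otimes>\<^bsub>G\<^esub> z)"
    if "x \<in> carrier G" "y \<in> carrier G" "z \<in> carrier G" for x y z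
    using that by (auto simp: carrier_G mult_G)
  show "\<one>\<^bsub>G\<^esub> \<otimes>\<^bsub>G\<^esub> x = x" if "x \<in> carrier G" for x
    using that by (auto simp: carrier_G one_G mult_G)
  show "\<exists>y\<in>carrier G. y \<otimes>\<^bsub>G\<^esub> x = \<one>\<^bsub>G\<^esub>" if "x \<in> carrier G" for x
    using that left_inverse by (fastforce simp: carrier_G one_G mult_G)
qed

lemma inv_e: "x \<in> X \<Longrightarrow> inv\<^bsub>G\<^esub> e x = W [(x, False)]"
  using W_cancel[of "[]" x False] by (intro G.inv_equality) (simp_all add: emb_def mult_G one_G)

lemma e_mult: "x \<in> X \<Longrightarrow> y \<in> X \<Longrightarrow> e x \<otimes>\<^bsub>G\<^esub> e y = e (l x y) \<otimes>\<^bsub>G\<^esub> e (\<rho> x y)"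
  using weq_rel[of "[]" X "[]" x y r] by (simp add: emb_def mult_G W_eq_iff)

lemma G_induct [consumes 1, case_names one mult inv]:
  assumes "a \<in> carrier G" "P \<one>\<^bsub>G\<^esub>"
    and "\<And>a x. a \<in> carrier G \<Longrightarrow> x \<in> X \<Longrightarrow> P a \<Longrightarrow> P (a \<otimes>\<^bsub>G\<^esub> e x)"
    and "\<And>a x. a \<in> carrier G \<Longrightarrow> x \<in> X \<Longrightarrow> P a \<Longrightarrow> P (a \<otimes>\<^bsub>G\<^esub> inv\<^bsub>G\<^esub> e x)"
  shows "P a"
proof -
  have "P (W u)" if "u \<in> words X" for u
    using that
  proof (induction u rule: rev_induct)
    case Nil
    then show ?case using assms(2) by (simp add: one_G)
  next
    case (snoc p u)
    obtain x b where p: "p = (x, b)" by (cases p)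
    have "W (u @ [p]) = W u \<otimes>\<^bsub>G\<^esub> (if b then e x else inv\<^bsub>G\<^esub> e x)"
      using snoc.prems p by (simp add: inv_e) (simp add: emb_def mult_G)
    then show ?case using snoc p assms(3,4) by simp
  qed
  then show ?thesis using assms(1) by (auto simp: carrier_G)
qed

lemma generate_e: "generate G (e ` X) = carrier G"
proof
  show "generate G (e ` X) \<subseteq> carrier G" by (rule G.generate_incl) auto
  have "a \<in> generate G (e ` X)" if "a \<in> carrier G" for a
    using that by (induction rule: G_induct) (auto intro: generate.intros)
  then show "carrier G \<subseteq> generate G (e ` X)" by blast
qed

text \<open>Words are evaluated in \<open>H\<close>; the generating steps of \<open>weq\<close>
  preserve the value, so it depends on the class only. This is the source of all homomorphisms out
  of \<open>G\<close> that are not built from others.\<close>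

lemma universal_property:
  assumes H: "group H" and f: "\<And>x. x \<in> X \<Longrightarrow> f x \<in> carrier H"
    and rel: "\<And>x y. x \<in> X \<Longrightarrow> y \<in> X \<Longrightarrow> f x \<otimes>\<^bsub>H\<^esub> f y = f (l x y) \<otimes>\<^bsub>H\<^esub> f (\<rho> x y)"
  obtains h where "h \<in> hom G H" "\<And>x. x \<in> X \<Longrightarrow> h (e x) = f x"
proof -
  interpret H: group H by (rule H)
  define ev where "ev w = foldr (\<lambda>(x, b) a. (if b then f x else inv\<^bsub>H\<^esub> f x) \<otimes>\<^bsub>H\<^esub> a) w \<one>\<^bsub>H\<^esub>" for w
  have ev_Nil: "ev [] = \<one>\<^bsub>H\<^esub>"
    and ev_Cons: "ev ((x, b) # w) = (if b then f x else inv\<^bsub>H\<^esub> f x) \<otimes>\<^bsub>H\<^esub> ev w" for x b w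
    by (simp_all add: ev_def)
  have ev_closed: "ev w \<in> carrier H" if "w \<in> words X" for w
    using that by (induction w) (auto simp: ev_Nil ev_Cons f)
  have ev_append: "ev (u @ v) = ev u \<otimes>\<^bsub>H\<^esub> ev v" if "u \<in> words X" "v \<in> words X" for u v
    using that by (induction u) (auto simp: ev_Nil ev_Cons f ev_closed H.m_assoc)
  have ev_weq: "ev u = ev v" if "weq X r u v" for u v
    using that
  proof (induction rule: weq.induct)
    case (weq_cancel u v x b)
    then have "ev [(x, b), (x, \<not> b)] = \<one>\<^bsub>H\<^esub>" by (simp add: ev_Nil ev_Cons f)
    then show ?case using weq_cancel ev_append[of "[(x, b), (x, \<not> b)]" v]
      by (simp add: ev_append ev_closed)
  next
    case (weq_rel u v x y)
    then have "ev [(x, True), (y, True)] = ev [(l x y, True), (\<rho> x y, True)]"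
      using rel[of x y] by (simp add: ev_Nil ev_Cons f)
    then show ?case using weq_rel ev_append[of "[(x, True), (y, True)]" v]
        ev_append[of "[(l x y, True), (\<rho> x y, True)]" v]
      by (simp add: ev_append)
  qed auto
  define h where "h A = ev (SOME w. w \<in> A)" for A
  have h: "h (W u) = ev u" if "u \<in> words X" for u
    unfolding h_def using ev_weq[OF weq_SOME[OF that]] by simp
  have "h \<in> hom G H"
    by (rule homI) (auto simp: carrier_G mult_G h ev_closed ev_append)
  moreover have "h (e x) = f x" if "x \<in> X" for x
    using that f by (simp add: emb_def h ev_Cons ev_Nil)
  ultimately show ?thesis using that by blast
qed

end

section \<open>Braces\<close>

text \<open>A left brace whose zero is the unit of the group. Additive inverses are replaced by
  cancellation, and the distributive law is accordingly stated without subtraction.\<close>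

locale brace = group G for G :: "'a monoid" (structure) +
  fixes add :: "'a \<Rightarrow> 'a \<Rightarrow> 'a" (infixl "\<oplus>" 65)
  assumes add_closed [simp]: "a \<in> carrier G \<Longrightarrow> b \<in> carrier G \<Longrightarrow> a \<oplus> b \<in> carrier G"
    and add_comm: "a \<in> carrier G \<Longrightarrow> b \<in> carrier G \<Longrightarrow> a \<oplus> b = b \<oplus> a"
    and add_assoc: "a \<in> carrier G \<Longrightarrow> b \<in> carrier G \<Longrightarrow> c \<in> carrier G \<Longrightarrow>
      (a \<oplus> b) \<oplus> c = a \<oplus> (b \<oplus> c)"
    and one_add [simp]: "a \<in> carrier G \<Longrightarrow> \<one> \<oplus> a = a"
    and add_cancel: "a \<in> carrier G \<Longrightarrow> b \<in> carrier G \<Longrightarrow> c \<in> carrier G \<Longrightarrow>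
      a \<oplus> c = b \<oplus> c \<Longrightarrow> a = b"
    and distrib: "a \<in> carrier G \<Longrightarrow> b \<in> carrier G \<Longrightarrow> c \<in> carrier G \<Longrightarrow>
      a \<otimes> (b \<oplus> c) \<oplus> a = (a \<otimes> b) \<oplus> (a \<otimes> c)"
begin

text \<open>This is the usual \<open>a \<otimes> b - a\<close>: by \<open>distrib\<close>, adding
  \<open>a\<close> to the right-hand side gives
  \<open>(a \<otimes> b) \<oplus> (a \<otimes> inv a)\<close>, which is
  \<open>a \<otimes> b\<close>.\<close>

definition lam where "lam a b = a \<otimes> (b \<oplus> inv a)"
definition rho where "rho a b = inv (lam a b) \<otimes> (a \<otimes> b)"

lemma lam_closed [simp]: "a \<in> carrier G \<Longrightarrow> b \<in> carrier G \<Longrightarrow> lam a b \<in> carrier G"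
  by (simp add: lam_def)

lemma rho_closed [simp]: "a \<in> carrier G \<Longrightarrow> b \<in> carrier G \<Longrightarrow> rho a b \<in> carrier G"
  by (simp add: rho_def)

lemma add_one [simp]: "a \<in> carrier G \<Longrightarrow> a \<oplus> \<one> = a"
  by (simp add: add_comm[of a])

lemma lam_add_self: "a \<in> carrier G \<Longrightarrow> b \<in> carrier G \<Longrightarrow> lam a b \<oplus> a = a \<otimes> b"
  by (simp add: lam_def distrib)

lemma lam_rho: "a \<in> carrier G \<Longrightarrow> b \<in> carrier G \<Longrightarrow> lam a b \<otimes> rho a b = a \<otimes> b"
  by (simp add: rho_def flip: m_assoc)

lemma lam_eqI:
  "a \<in> carrier G \<Longrightarrow> b \<in> carrier G \<Longrightarrow> c \<in> carrier G \<Longrightarrow> c \<oplus> a = a \<otimes> b \<Longrightarrow> lam a b = c"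
  using add_cancel[of "lam a b" c a] by (simp add: lam_add_self)

text \<open>After adding \<open>a\<close> twice, the right-hand side becomes
  \<open>(a \<otimes> b) \<oplus> (a \<otimes> c)\<close>, to which \<open>distrib\<close> applies;
  both copies of \<open>a\<close> are then cancelled.\<close>

lemma lam_add:
  assumes [simp]: "a \<in> carrier G" "b \<in> carrier G" "c \<in> carrier G"
  shows "lam a (b \<oplus> c) = lam a b \<oplus> lam a c"
proof -
  have "(lam a b \<oplus> lam a c \<oplus> a) \<oplus> a = (lam a b \<oplus> a) \<oplus> (lam a c \<oplus> a)"
    by (simp add: add_assoc add_comm[of a "lam a c \<oplus> a"])
  also have "\<dots> = a \<otimes> (b \<oplus> c) \<oplus> a"
    by (simp add: lam_add_self distrib)
  finally have "lam a b \<oplus> lam a c \<oplus> a = a \<otimes> (b \<oplus> c)"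
    by (rule add_cancel[rotated 3]) simp_all
  then show ?thesis by (intro lam_eqI) simp_all
qed

lemma lam_mult:
  assumes [simp]: "a \<in> carrier G" "b \<in> carrier G" "c \<in> carrier G"
  shows "lam (a \<otimes> b) c = lam a (lam b c)"
proof (rule lam_eqI)
  have "lam a (lam b c) \<oplus> a \<otimes> b = lam a (lam b c) \<oplus> lam a b \<oplus> a"
    by (simp add: lam_add_self add_assoc)
  also have "\<dots> = a \<otimes> (b \<otimes> c)"
    by (simp add: lam_add_self flip: lam_add)
  finally show "lam a (lam b c) \<oplus> a \<otimes> b = a \<otimes> b \<otimes> c"
    by (simp add: m_assoc)
qed simp_all

text \<open>Write \<open>u \<otimes> v\<close> as \<open>lam u v \<oplus> u\<close> and use
  additivity of \<open>lam a\<close>. The composite of \<open>lam a\<close> and \<open>lam u\<close>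
  is the action of \<open>a \<otimes> u = lam a u \<otimes> rho a u\<close>, which splits
  again.\<close>

lemma lam_mult_right:
  assumes [simp]: "a \<in> carrier G" "u \<in> carrier G" "v \<in> carrier G"
  shows "lam a (u \<otimes> v) = lam a u \<otimes> lam (rho a u) v"
proof -
  have "lam a (u \<otimes> v) = lam a (lam u v) \<oplus> lam a u"
    by (simp add: lam_add_self flip: lam_add)
  also have "\<dots> = lam (lam a u) (lam (rho a u) v) \<oplus> lam a u"
    by (simp add: lam_rho flip: lam_mult)
  finally show ?thesis by (simp add: lam_add_self)
qed

text \<open>Involutivity expresses commutativity of the addition: \<open>a \<oplus> lam a b\<close>
  equals \<open>lam a b \<oplus> a = a \<otimes> b = lam a b \<otimes> rho a b\<close>.\<close>

lemma lam_rho_invol: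
  assumes [simp]: "a \<in> carrier G" "b \<in> carrier G"
  shows "lam (lam a b) (rho a b) = a"
  by (rule lam_eqI) (simp_all add: lam_rho lam_add_self add_comm[of a])

lemma rho_mult_right:
  assumes [simp]: "a \<in> carrier G" "u \<in> carrier G" "v \<in> carrier G"
  shows "rho a (u \<otimes> v) = rho (rho a u) v"
proof -
  have "rho (rho a u) v = inv (lam (rho a u) v) \<otimes> (inv (lam a u) \<otimes> (a \<otimes> u) \<otimes> v)"
    by (simp add: rho_def)
  then show ?thesis
    by (simp add: rho_def[of a "u \<otimes> v"] lam_mult_right inv_mult_group m_assoc)
qed

lemma rho_mult:
  assumes [simp]: "a \<in> carrier G" "b \<in> carrier G" "u \<in> carrier G"
  shows "rho (a \<otimes> b) u = rho a (lam b u) \<otimes> rho b u"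
proof -
  have "a \<otimes> lam b u \<otimes> rho b u = a \<otimes> b \<otimes> u"
    by (simp add: m_assoc lam_rho)
  then show ?thesis
    by (simp add: rho_def[of "a \<otimes> b"] rho_def[of a] lam_mult m_assoc)
qed

theorem symmetric_group: "symmetric_group G (\<lambda>a b. (lam a b, rho a b))"
proof -
  have rho_invol: "rho (lam a b) (rho a b) = b" if "a \<in> carrier G" "b \<in> carrier G" for a b
    using that by (simp add: rho_def[of "lam a b"] lam_rho lam_rho_invol flip: m_assoc)
  have lam_one: "lam a \<one> = \<one>" "lam \<one> a = a" if "a \<in> carrier G" for a
    using that by (auto intro: lam_eqI)
  have bij: "bij_betw (\<lambda>(a, b). (lam a b, rho a b)) (carrier G \<times> carrier G) (carrier G \<times> carrier G)"
    by (rule bij_betw_byWitness[where f' = "\<lambda>(a, b). (lam a b, rho a b)"])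
       (auto simp: lam_rho_invol rho_invol)
  show ?thesis
    unfolding symmetric_group_def lact_def ract_def
    using bij is_group
    by (auto simp: lam_rho_invol rho_invol lam_mult lam_mult_right rho_mult rho_mult_right lam_rho)
       (simp_all add: rho_def lam_one)
qed

end

section \<open>The braiding of the structure group\<close>

context symset
begin

section \<open>The action on \<open>X\<close> and the translations of \<open>G\<close>\<close>

text \<open>The unknown is the acting element, so bijectivity of \<open>l x\<close> does not solve
  the equation directly. Involutivity turns it into \<open>\<rho> x w = w\<close>, which has exactly
  one solution by \<open>\<rho>_bij\<close>.\<close>

lemma ex1_fixed:
  assumes w: "w \<in> X"
  shows "\<exists>!x. x \<in> X \<and> l x w = x"
proof -
  have "l x w = x \<longleftrightarrow> \<rho> x w = w" if x: "x \<in> X" for x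
  proof
    assume eq: "l x w = x"
    then have "l x (\<rho> x w) = l x w" using r_invol[OF x w] by simp
    then show "\<rho> x w = w"
      using l_bij[OF x] x w unfolding bij_betw_def by (meson inj_onD \<rho>_closed)
  next
    assume eq: "\<rho> x w = w"
    then have "\<rho> (l x w) w = \<rho> x w" using r_invol[OF x w] by simp
    then show "l x w = x"
      using \<rho>_bij[OF w] x w unfolding bij_betw_def by (meson inj_onD l_closed)
  qed
  moreover have "\<exists>!x. x \<in> X \<and> \<rho> x w = w"
  proof -
    have inj: "inj_on (\<lambda>x. \<rho> x w) X" and "w \<in> (\<lambda>x. \<rho> x w) ` X"
      using \<rho>_bij[OF w] w by (simp_all add: bij_betw_def)
    then obtain x where x: "w = \<rho> x w" "x \<in> X" by blast
    have "x' = x" if "x' \<in> X" "\<rho> x' w = w" for x'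
      by (rule inj_onD[OF inj trans[OF that(2) x(1)] that(1) x(2)])
    then show ?thesis using x by metis
  qed
  ultimately show ?thesis by auto
qed

text \<open>The permutation action, available before any braiding exists; \<open>Lmap_eq_act\<close>
  later identifies it with \<open>Lmap\<close>.\<close>

definition act :: "('a \<times> bool) list set \<Rightarrow> 'a \<Rightarrow> 'a" where
  "act = (SOME h. h \<in> hom G (BijGroup X) \<and> (\<forall>x\<in>X. h (e x) = restrict (l x) X))"

lemma act_hom: "act \<in> hom G (BijGroup X)"
  and act_e_restrict: "x \<in> X \<Longrightarrow> act (e x) = restrict (l x) X"
proof -
  have closed: "restrict (l x) X \<in> carrier (BijGroup X)" if "x \<in> X" for x
    using l_bij[OF that] by (simp add: BijGroup_def Bij_def bij_betw_restrict_eq)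
  have "restrict (l x) X \<otimes>\<^bsub>BijGroup X\<^esub> restrict (l y) X =
      restrict (l (l x y)) X \<otimes>\<^bsub>BijGroup X\<^esub> restrict (l (\<rho> x y)) X"
    if "x \<in> X" "y \<in> X" for x y
    using that closed by (auto simp: BijGroup_def compose_def l_comp)
  then obtain h where "h \<in> hom G (BijGroup X)" "\<And>x. x \<in> X \<Longrightarrow> h (e x) = restrict (l x) X"
    using universal_property[OF group_BijGroup, of "\<lambda>x. restrict (l x) X"] closed by blast
  then have "\<exists>h. h \<in> hom G (BijGroup X) \<and> (\<forall>x\<in>X. h (e x) = restrict (l x) X)"
    by blast
  then have "act \<in> hom G (BijGroup X) \<and> (\<forall>x\<in>X. act (e x) = restrict (l x) X)"
    unfolding act_def by (rule someI_ex)
  then show "act \<in> hom G (BijGroup X)" "x \<in> X \<Longrightarrow> act (e x) = restrict (l x) X"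
    by auto
qed

lemma act_Bij: "a \<in> carrier G \<Longrightarrow> act a \<in> Bij X"
  using act_hom by (auto simp: hom_def BijGroup_def)

lemma act_closed [simp]: "a \<in> carrier G \<Longrightarrow> x \<in> X \<Longrightarrow> act a x \<in> X"
  using act_Bij Bij_imp_funcset by blast

lemma act_mult: "a \<in> carrier G \<Longrightarrow> b \<in> carrier G \<Longrightarrow> x \<in> X \<Longrightarrow> act (a \<otimes>\<^bsub>G\<^esub> b) x = act a (act b x)"
  using act_hom act_Bij by (auto simp: hom_def BijGroup_def compose_def)

lemma act_e [simp]: "x \<in> X \<Longrightarrow> y \<in> X \<Longrightarrow> act (e x) y = l x y"
  by (simp add: act_e_restrict)

lemma act_one [simp]:
  assumes "x \<in> X"
  shows "act \<one>\<^bsub>G\<^esub> x = x"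
proof -
  interpret group_hom G "BijGroup X" act
    using act_hom by (simp add: group_hom_def group_hom_axioms_def group_BijGroup)
  show ?thesis using assms hom_one by (simp add: BijGroup_def)
qed

lemma act_inv [simp]: "a \<in> carrier G \<Longrightarrow> x \<in> X \<Longrightarrow> act a (act (inv\<^bsub>G\<^esub> a) x) = x"
  and inv_act [simp]: "a \<in> carrier G \<Longrightarrow> x \<in> X \<Longrightarrow> act (inv\<^bsub>G\<^esub> a) (act a x) = x"
  by (simp_all flip: act_mult)

text \<open>\<open>transl y\<close> is the map adding \<open>y\<close> in the brace structure to be constructed.\<close>
definition transl where "transl y p = p \<otimes>\<^bsub>G\<^esub> e (act (inv\<^bsub>G\<^esub> p) y)"

lemma transl_closed [simp]: "y \<in> X \<Longrightarrow> p \<in> carrier G \<Longrightarrow> transl y p \<in> carrier G"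
  by (simp add: transl_def)

lemma transl_bij:
  assumes y: "y \<in> X"
  shows "bij_betw (transl y) (carrier G) (carrier G)"
proof -
  have step: "l x (act (inv\<^bsub>G\<^esub> q) y) = x"
    if "p \<in> carrier G" "q = transl y p" "x = act (inv\<^bsub>G\<^esub> p) y" for p q x
  proof -
    have x: "x \<in> X" using that(1,3) y by simp
    have q: "q \<in> carrier G" using that(1,2) y by simp
    have "q = p \<otimes>\<^bsub>G\<^esub> e x" using that(2,3) by (simp add: transl_def)
    then have "p = q \<otimes>\<^bsub>G\<^esub> inv\<^bsub>G\<^esub> e x" using that(1) x by (simp add: G.m_assoc)
    then have "inv\<^bsub>G\<^esub> p = e x \<otimes>\<^bsub>G\<^esub> inv\<^bsub>G\<^esub> q"
      using q x by (simp add: G.inv_mult_group)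
    then have "act (inv\<^bsub>G\<^esub> p) y = l x (act (inv\<^bsub>G\<^esub> q) y)"
      using q x y by (simp add: act_mult)
    then show ?thesis unfolding that(3)[symmetric] by (rule sym)
  qed
  have "inj_on (transl y) (carrier G)"
  proof (rule inj_onI)
    fix p p' assume p: "p \<in> carrier G" "p' \<in> carrier G" and eq: "transl y p = transl y p'"
    let ?x = "act (inv\<^bsub>G\<^esub> p) y" and ?x' = "act (inv\<^bsub>G\<^esub> p') y"
    have X: "?x \<in> X" "?x' \<in> X" using p y by simp_all
    have w: "act (inv\<^bsub>G\<^esub> transl y p) y \<in> X" using p y by simp
    have "?x = ?x'"
      using ex1_fixed[OF w] X step[OF p(1) refl refl] step[OF p(2) eq refl] by blast
    then show "p = p'" using eq p X by (simp add: transl_def)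
  qed
  moreover have "q \<in> transl y ` carrier G" if q: "q \<in> carrier G" for q
  proof -
    have w: "act (inv\<^bsub>G\<^esub> q) y \<in> X" using q y by simp
    obtain x where x: "x \<in> X" "l x (act (inv\<^bsub>G\<^esub> q) y) = x" using ex1_fixed[OF w] by blast
    define p where "p = q \<otimes>\<^bsub>G\<^esub> inv\<^bsub>G\<^esub> e x"
    have "act (inv\<^bsub>G\<^esub> p) y = x"
      using q x y by (simp add: p_def G.inv_mult_group act_mult)
    then have "transl y p = q" using q x by (simp add: transl_def p_def G.m_assoc)
    then show ?thesis using q x by (auto simp: p_def)
  qed
  ultimately show ?thesis using y by (auto simp: bij_betw_def)
qed

lemma transl_inj: "y \<in> X \<Longrightarrow> p \<in> carrier G \<Longrightarrow> q \<in> carrier G \<Longrightarrow> transl y p = transl y q \<Longrightarrow> p = q"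
  using transl_bij by (auto simp: bij_betw_def inj_on_def)

text \<open>Let \<open>u\<close> and \<open>v\<close> be the images of \<open>y\<close> and
  \<open>z\<close> under the inverse of \<open>p\<close>. The two composites multiply
  \<open>p\<close> by the two sides of a defining relation, since \<open>r\<close> sends
  \<open>(u, y')\<close> to \<open>v\<close> and the element that \<open>v\<close> moves to
  \<open>u\<close>.\<close>

lemma transl_commute:
  assumes y: "y \<in> X" and z: "z \<in> X" and p: "p \<in> carrier G"
  shows "transl z (transl y p) = transl y (transl z p)"
proof -
  have step: "transl z (transl y p) = p \<otimes>\<^bsub>G\<^esub> (e u \<otimes>\<^bsub>G\<^esub> e (act (inv\<^bsub>G\<^esub> e u) v))"
    if "y \<in> X" "z \<in> X" "u = act (inv\<^bsub>G\<^esub> p) y" "v = act (inv\<^bsub>G\<^esub> p) z" for y z u v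
    using that p by (simp add: transl_def G.inv_mult_group act_mult G.m_assoc)
  define u v where "u = act (inv\<^bsub>G\<^esub> p) y" and "v = act (inv\<^bsub>G\<^esub> p) z"
  have uv: "u \<in> X" "v \<in> X" using assms by (simp_all add: u_def v_def)
  define y' where "y' = act (inv\<^bsub>G\<^esub> e u) v"
  have y': "y' \<in> X" "l u y' = v"
    using uv act_inv[of "e u" v] by (simp_all add: y'_def del: act_inv)
  have "l v (\<rho> u y') = u" using r_invol[OF uv(1) y'(1)] y' by simp
  then have "\<rho> u y' = act (inv\<^bsub>G\<^esub> e v) u"
    using uv y' inv_act[of "e v" "\<rho> u y'"] by (simp del: inv_act)
  then have "e u \<otimes>\<^bsub>G\<^esub> e y' = e v \<otimes>\<^bsub>G\<^esub> e (act (inv\<^bsub>G\<^esub> e v) u)"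
    using e_mult[OF uv(1) y'(1)] y' by simp
  then show ?thesis
    using step[OF y z u_def v_def] step[OF z y v_def u_def] by (simp add: y'_def)
qed

text \<open>Left multiplication permutes the translations by conjugation; distributivity in the
  brace comes from this.\<close>

lemma mult_transl:
  assumes "a \<in> carrier G" "y \<in> X" "p \<in> carrier G"
  shows "a \<otimes>\<^bsub>G\<^esub> transl y p = transl (act a y) (a \<otimes>\<^bsub>G\<^esub> p)"
  using assms by (simp add: transl_def G.inv_mult_group act_mult G.m_assoc)

lemma mult_e_eq_transl: "p \<in> carrier G \<Longrightarrow> x \<in> X \<Longrightarrow> p \<otimes>\<^bsub>G\<^esub> e x = transl (act p x) p"
  by (simp add: transl_def)

text \<open>The translations generate an abelian group acting transitively on \<open>G\<close>, so this group is
  its own centralizer \<open>TC\<close> and acts regularly.\<close>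
definition TC where
  "TC = {\<alpha>. bij_betw \<alpha> (carrier G) (carrier G) \<and>
     (\<forall>y\<in>X. \<forall>p\<in>carrier G. \<alpha> (transl y p) = transl y (\<alpha> p))}"

lemma TC_bij: "\<alpha> \<in> TC \<Longrightarrow> bij_betw \<alpha> (carrier G) (carrier G)"
  by (simp add: TC_def)

lemma TC_closed: "\<alpha> \<in> TC \<Longrightarrow> p \<in> carrier G \<Longrightarrow> \<alpha> p \<in> carrier G"
  using TC_bij by (auto dest: bij_betwE)

lemma TC_transl: "\<alpha> \<in> TC \<Longrightarrow> y \<in> X \<Longrightarrow> p \<in> carrier G \<Longrightarrow> \<alpha> (transl y p) = transl y (\<alpha> p)"
  by (simp add: TC_def)

lemma transl_TC: "y \<in> X \<Longrightarrow> transl y \<in> TC"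
  by (simp add: TC_def transl_bij transl_commute)

lemma TC_comp: "\<alpha> \<in> TC \<Longrightarrow> \<beta> \<in> TC \<Longrightarrow> (\<lambda>p. \<alpha> (\<beta> p)) \<in> TC"
  using bij_betw_trans[OF TC_bij TC_bij, of \<beta> \<alpha>] TC_closed[of \<beta>]
  by (simp add: TC_def comp_def)

text \<open>Every element of \<open>G\<close> is reached from the unit by translations and their
  inverses, with which both maps commute.\<close>

lemma TC_eqI:
  assumes "\<alpha> \<in> TC" "\<beta> \<in> TC" "\<alpha> \<one>\<^bsub>G\<^esub> = \<beta> \<one>\<^bsub>G\<^esub>" "g \<in> carrier G"
  shows "\<alpha> g = \<beta> g"
  using assms(4)
proof (induction rule: G_induct)
  case one
  then show ?case by (rule assms(3))
next
  case (mult a x)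
  then show ?case using assms(1,2) by (simp add: mult_e_eq_transl TC_transl)
next
  case (inv a x)
  define b where "b = a \<otimes>\<^bsub>G\<^esub> inv\<^bsub>G\<^esub> e x"
  have b: "b \<in> carrier G" "a = transl (act b x) b"
    using inv by (simp_all add: b_def G.m_assoc flip: mult_e_eq_transl)
  have "transl (act b x) (\<alpha> b) = transl (act b x) (\<beta> b)"
    using inv b assms(1,2) by (metis TC_transl act_closed)
  then have "\<alpha> b = \<beta> b"
    by (rule transl_inj[rotated 3]) (use inv b assms in \<open>auto simp: TC_closed\<close>)
  then show ?case by (simp add: b_def)
qed

text \<open>Commutation with all of \<open>TC\<close> is carried through the induction; it makes the
  addition commutative.\<close>

lemma ex_TC:
  assumes "g \<in> carrier G"
  shows "\<exists>\<alpha>\<in>TC. \<alpha> \<one>\<^bsub>G\<^esub> = g \<and> (\<forall>\<beta>\<in>TC. \<forall>p\<in>carrier G. \<alpha> (\<beta> p) = \<beta> (\<alpha> p))"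
  using assms
proof (induction rule: G_induct)
  case one
  show ?case by (rule bexI[of _ "\<lambda>p. p"]) (auto simp: TC_def bij_betw_def)
next
  case (mult a x)
  then obtain \<alpha> where \<alpha>: "\<alpha> \<in> TC" "\<alpha> \<one>\<^bsub>G\<^esub> = a"
    "\<forall>\<beta>\<in>TC. \<forall>p\<in>carrier G. \<alpha> (\<beta> p) = \<beta> (\<alpha> p)" by blast
  show ?case
    by (rule bexI[of _ "\<lambda>p. transl (act a x) (\<alpha> p)"])
       (use \<alpha> mult in \<open>simp_all add: TC_comp transl_TC mult_e_eq_transl TC_transl TC_closed\<close>)
next
  case (inv a x)
  then obtain \<alpha> where \<alpha>: "\<alpha> \<in> TC" "\<alpha> \<one>\<^bsub>G\<^esub> = a"
    "\<forall>\<beta>\<in>TC. \<forall>p\<in>carrier G. \<alpha> (\<beta> p) = \<beta> (\<alpha> p)" by blast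
  define b where "b = a \<otimes>\<^bsub>G\<^esub> inv\<^bsub>G\<^esub> e x"
  define y where "y = act b x"
  \<comment> \<open>Subtraction of \<open>y\<close>: it lies in \<open>TC\<close>, since a map
    commuting with a bijection commutes with its inverse.\<close>
  define s where "s = inv_into (carrier G) (transl y)"
  have b: "b \<in> carrier G" using inv by (simp add: b_def)
  have y: "y \<in> X" using inv b by (simp add: y_def)
  have a: "a = transl y b"
    using inv b by (simp add: y_def G.m_assoc flip: mult_e_eq_transl) (simp add: b_def G.m_assoc)
  have s: "bij_betw s (carrier G) (carrier G)"
    unfolding s_def by (rule bij_betw_inv_into[OF transl_bij[OF y]])
  then have s_closed: "s p \<in> carrier G" if "p \<in> carrier G" for p
    using that by (auto dest: bij_betwE)
  have t_s: "transl y (s p) = p" if "p \<in> carrier G" for p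
    using that transl_bij[OF y] unfolding s_def by (simp add: bij_betw_inv_into_right)
  have s_comm: "\<beta> (s p) = s (\<beta> p)" if "\<beta> \<in> TC" "p \<in> carrier G" for \<beta> p
  proof (rule transl_inj[OF y])
    have "transl y (\<beta> (s p)) = \<beta> (transl y (s p))"
      using that y s_closed by (intro TC_transl[symmetric])
    also have "\<dots> = \<beta> p" using that by (simp only: t_s)
    also have "\<dots> = transl y (s (\<beta> p))" using that by (simp only: t_s TC_closed)
    finally show "transl y (\<beta> (s p)) = transl y (s (\<beta> p))" .
  qed (use that s_closed in \<open>auto simp: TC_closed\<close>)
  have "s \<in> TC"
    unfolding TC_def using s s_comm[OF transl_TC] by simp
  have "s a = b"
    using transl_inj[OF y s_closed[OF inv(1)] b] t_s[OF inv(1)] a by simp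
  then have "s (\<alpha> \<one>\<^bsub>G\<^esub>) = a \<otimes>\<^bsub>G\<^esub> inv\<^bsub>G\<^esub> e x"
    using \<alpha>(2) by (simp add: b_def)
  moreover have "s (\<alpha> (\<beta> p)) = \<beta> (s (\<alpha> p))" if "\<beta> \<in> TC" "p \<in> carrier G" for \<beta> p
    using that \<alpha>(3) s_comm[OF that(1) TC_closed[OF \<alpha>(1) that(2)]] by simp
  ultimately show ?case
    using TC_comp[OF \<open>s \<in> TC\<close> \<alpha>(1)] by (intro bexI[of _ "\<lambda>p. s (\<alpha> p)"]) auto
qed

section \<open>The addition on \<open>G\<close>\<close>

text \<open>Evaluation at the unit identifies \<open>TC\<close>, as maps on the carrier, with
  \<open>G\<close>; the addition is composition in \<open>TC\<close> under this
  identification.\<close>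

definition plus where
  "plus g = (SOME \<alpha>. \<alpha> \<in> TC \<and> \<alpha> \<one>\<^bsub>G\<^esub> = g \<and> (\<forall>\<beta>\<in>TC. \<forall>p\<in>carrier G. \<alpha> (\<beta> p) = \<beta> (\<alpha> p)))"

lemma plus_TC: "g \<in> carrier G \<Longrightarrow> plus g \<in> TC"
  and plus_one: "g \<in> carrier G \<Longrightarrow> plus g \<one>\<^bsub>G\<^esub> = g"
  and plus_commute: "g \<in> carrier G \<Longrightarrow> \<beta> \<in> TC \<Longrightarrow> p \<in> carrier G \<Longrightarrow> plus g (\<beta> p) = \<beta> (plus g p)"
proof -
  assume "g \<in> carrier G"
  then have "\<exists>\<alpha>. \<alpha> \<in> TC \<and> \<alpha> \<one>\<^bsub>G\<^esub> = g \<and> (\<forall>\<beta>\<in>TC. \<forall>p\<in>carrier G. \<alpha> (\<beta> p) = \<beta> (\<alpha> p))"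
    using ex_TC by blast
  from someI_ex[OF this] show "plus g \<in> TC" "plus g \<one>\<^bsub>G\<^esub> = g"
    "\<beta> \<in> TC \<Longrightarrow> p \<in> carrier G \<Longrightarrow> plus g (\<beta> p) = \<beta> (plus g p)"
    unfolding plus_def by blast+
qed

lemma TC_eq_plus: "\<alpha> \<in> TC \<Longrightarrow> p \<in> carrier G \<Longrightarrow> \<alpha> p = plus (\<alpha> \<one>\<^bsub>G\<^esub>) p"
  by (rule TC_eqI) (simp_all add: plus_TC plus_one TC_closed)

lemma plus_closed [simp]: "a \<in> carrier G \<Longrightarrow> b \<in> carrier G \<Longrightarrow> plus a b \<in> carrier G"
  by (simp add: plus_TC TC_closed)

lemma plus_comm: "a \<in> carrier G \<Longrightarrow> b \<in> carrier G \<Longrightarrow> plus a b = plus b a"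
  using plus_commute[of a "plus b" "\<one>\<^bsub>G\<^esub>"] by (simp add: plus_TC plus_one)

lemma plus_assoc:
  assumes "a \<in> carrier G" "b \<in> carrier G" "c \<in> carrier G"
  shows "plus (plus a b) c = plus a (plus b c)"
  using TC_eq_plus[OF TC_comp[OF plus_TC plus_TC], of a b c] assms by (simp add: plus_one)

lemma mult_conj_TC:
  assumes a: "a \<in> carrier G" and \<alpha>: "\<alpha> \<in> TC"
  shows "(\<lambda>p. a \<otimes>\<^bsub>G\<^esub> \<alpha> (inv\<^bsub>G\<^esub> a \<otimes>\<^bsub>G\<^esub> p)) \<in> TC"
proof -
  have "bij_betw (\<lambda>p. a \<otimes>\<^bsub>G\<^esub> p) (carrier G) (carrier G)" if "a \<in> carrier G" for a
    by (rule bij_betw_byWitness[where f' = "\<lambda>p. inv\<^bsub>G\<^esub> a \<otimes>\<^bsub>G\<^esub> p"])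
       (use that in \<open>auto simp flip: G.m_assoc\<close>)
  then have "bij_betw ((\<lambda>p. a \<otimes>\<^bsub>G\<^esub> p) \<circ> (\<alpha> \<circ> (\<lambda>p. inv\<^bsub>G\<^esub> a \<otimes>\<^bsub>G\<^esub> p))) (carrier G) (carrier G)"
    using a TC_bij[OF \<alpha>] by (blast intro: bij_betw_trans G.inv_closed)
  then show ?thesis
    using a \<alpha> by (simp add: TC_def comp_def mult_transl TC_closed TC_transl)
qed

lemma brace_plus: "brace G plus"
proof unfold_locales
  show "plus a b = plus b a" if "a \<in> carrier G" "b \<in> carrier G" for a b
    using that by (rule plus_comm)
  show "plus \<one>\<^bsub>G\<^esub> a = a" if "a \<in> carrier G" for a
    using plus_comm[of "\<one>\<^bsub>G\<^esub>" a] that by (simp add: plus_one)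
  show "a = b" if "a \<in> carrier G" "b \<in> carrier G" "c \<in> carrier G" "plus a c = plus b c" for a b c
  proof (rule inj_onD)
    show "inj_on (plus c) (carrier G)"
      using TC_bij[OF plus_TC[OF that(3)]] by (rule bij_betw_imp_inj_on)
  qed (use that in \<open>simp_all add: plus_comm\<close>)
  show "plus (a \<otimes>\<^bsub>G\<^esub> plus b c) a = plus (a \<otimes>\<^bsub>G\<^esub> b) (a \<otimes>\<^bsub>G\<^esub> c)"
    if [simp]: "a \<in> carrier G" "b \<in> carrier G" "c \<in> carrier G" for a b c
  proof -
    \<comment> \<open>The value at the unit of \<open>plus b\<close> conjugated by left
      multiplication by \<open>a\<close>. The conjugate lies in \<open>TC\<close>, so it is
      \<open>plus k\<close>.\<close>
    define k where "k = a \<otimes>\<^bsub>G\<^esub> plus b (inv\<^bsub>G\<^esub> a)"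
    have k [simp]: "k \<in> carrier G" by (simp add: k_def)
    have conj: "a \<otimes>\<^bsub>G\<^esub> plus b g = plus k (a \<otimes>\<^bsub>G\<^esub> g)" if "g \<in> carrier G" for g
      using TC_eq_plus[OF mult_conj_TC[OF _ plus_TC], of a b "a \<otimes>\<^bsub>G\<^esub> g"] that
      by (simp add: k_def flip: G.m_assoc)
    have "a \<otimes>\<^bsub>G\<^esub> b = plus k a" using conj[of "\<one>\<^bsub>G\<^esub>"] by (simp add: plus_one)
    then show ?thesis
      by (simp add: conj plus_assoc plus_comm[of a])
  qed
qed (simp_all add: plus_assoc)

sublocale B: brace G plus by (rule brace_plus)

section \<open>Existence and uniqueness of the braiding\<close>

text \<open>Adding \<open>e x\<close> is the translation by \<open>x\<close>, since both lie in
  \<open>TC\<close> and agree at the unit.\<close>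

lemma lam_e:
  assumes "a \<in> carrier G" "x \<in> X"
  shows "B.lam a (e x) = e (act a x)"
proof -
  have "plus (e x) (inv\<^bsub>G\<^esub> a) = transl x (inv\<^bsub>G\<^esub> a)"
    using assms TC_eq_plus[OF transl_TC, of x "inv\<^bsub>G\<^esub> a"] mult_e_eq_transl[of "\<one>\<^bsub>G\<^esub>" x] by simp
  then show ?thesis
    using assms by (simp add: B.lam_def transl_def flip: G.m_assoc)
qed

lemma rho_e:
  assumes "x \<in> X" "y \<in> X"
  shows "B.rho (e x) (e y) = e (\<rho> x y)"
  using assms by (simp add: B.rho_def lam_e e_mult[of x y] flip: G.m_assoc)

text \<open>The identity of \<open>G\<close> is viewed as a morphism from the brace braiding to
  \<open>\<sigma>\<close>; on the generators it is one by assumption.\<close>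

lemma extension_unique:
  assumes "symmetric_group G \<sigma>" "\<forall>x\<in>X. \<forall>y\<in>X. \<sigma> (e x) (e y) = (e (l x y), e (\<rho> x y))"
    and ab: "a \<in> carrier G" "b \<in> carrier G"
  shows "\<sigma> a b = (B.lam a b, B.rho a b)"
proof -
  have "l x ` X = X" if "x \<in> X" for x using l_bij[OF that] by (simp add: bij_betw_def)
  then have im: "(\<lambda>y. e (l x y)) ` X = e ` X" if "x \<in> X" for x
    using that image_image[of e "l x" X] by simp
  have "\<sigma> (id a) (id b) = map_prod id id (B.lam a b, B.rho a b)"
    by (rule hom_braiding_from_generators[OF B.symmetric_group assms(1), of id "e ` X"])
       (use ab generate_e im assms(2) in \<open>auto simp: hom_def lact_def lam_e image_image\<close>)
  then show ?thesis by simp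
qed

lemma struct_braiding:
  assumes "a \<in> carrier G" "b \<in> carrier G"
  shows "struct_braiding X r a b = (B.lam a b, B.rho a b)"
proof -
  have "(THE p. \<exists>\<sigma>. symmetric_group G \<sigma> \<and>
      (\<forall>x\<in>X. \<forall>y\<in>X. \<sigma> (e x) (e y) = (e (l x y), e (\<rho> x y))) \<and> \<sigma> a b = p) = (B.lam a b, B.rho a b)"
  proof (rule the_equality)
    show "\<exists>\<sigma>. symmetric_group G \<sigma> \<and>
      (\<forall>x\<in>X. \<forall>y\<in>X. \<sigma> (e x) (e y) = (e (l x y), e (\<rho> x y))) \<and> \<sigma> a b = (B.lam a b, B.rho a b)"
      by (rule exI[of _ "\<lambda>a b. (B.lam a b, B.rho a b)"]) (simp add: B.symmetric_group lam_e rho_e)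
  qed (use extension_unique assms in blast)
  then show ?thesis using assms by (simp add: struct_braiding_def)
qed

text \<open>The two braidings agree only on the carrier, so the axioms are transported along the
  identity rather than rewritten.\<close>

lemma symmetric_group_struct: "symmetric_group G (struct_braiding X r)"
proof -
  have "sym_epi id (G, \<lambda>a b. (B.lam a b, B.rho a b)) (G, struct_braiding X r)"
    by (simp add: sym_epi_def struct_braiding)
  then show ?thesis
    using sym_epi_symgroup[of "(G, \<lambda>a b. (B.lam a b, B.rho a b))"] B.symmetric_group by fastforce
qed

sublocale S: symgrp G "struct_braiding X r"
  by unfold_locales (rule symmetric_group_struct)

lemma L_e: "a \<in> carrier G \<Longrightarrow> x \<in> X \<Longrightarrow> S.L a (e x) = e (act a x)"
  by (simp add: lact_def struct_braiding lam_e)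

lemma R_e: "x \<in> X \<Longrightarrow> y \<in> X \<Longrightarrow> S.R (e x) (e y) = e (\<rho> x y)"
  by (simp add: ract_def struct_braiding rho_e)

section \<open>Injectivity of the map from \<open>X\<close> to \<open>G\<close>\<close>

text \<open>The generator \<open>x\<close> acts by \<open>h \<mapsto> \<delta>\<^sub>x + h \<circ> (l x)\<inverse>\<close>.\<close>
lemma affine_action:
  "\<exists>h \<in> hom G (BijGroup (UNIV :: ('a \<Rightarrow> int) set)).
     \<forall>x\<in>X. h (e x) (\<lambda>_. 0) = (\<lambda>y. if y = x then 1 else 0)"
proof -
  \<comment> \<open>The identity outside \<open>X\<close> extends \<open>l x\<close> to the whole
    type, on which the functions are defined.\<close>
  define s where "s x y = (if y \<in> X then l x y else y)" for x y
  have bij_s: "bij (s x)" if "x \<in> X" for x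
  proof -
    have "bij_betw (s x) X X"
      using l_bij[OF that] by (rule bij_betw_cong[THEN iffD1, rotated]) (simp add: s_def)
    moreover have "bij_betw (s x) (- X) (- X)"
      by (auto simp: bij_betw_def inj_on_def s_def)
    ultimately have "bij_betw (s x) (X \<union> - X) (X \<union> - X)"
      by (rule bij_betw_combine) simp
    then show ?thesis by simp
  qed
  define f :: "'a \<Rightarrow> ('a \<Rightarrow> int) \<Rightarrow> 'a \<Rightarrow> int"
    where "f x h y = (if y = x then 1 else 0) + h (inv_into UNIV (s x) y)" for x h y
  have f: "bij (f x)" if "x \<in> X" for x
    by (rule bij_betw_byWitness[where f' = "\<lambda>h y. h (s x y) - (if s x y = x then 1 else 0)"])
       (use bij_s[OF that] in \<open>auto simp: f_def bij_is_inj bij_is_surj surj_f_inv_f\<close>)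
  \<comment> \<open>Replacing \<open>(x, y)\<close> by \<open>r x y\<close> exchanges the first two
    summands, because \<open>l (l x y) (\<rho> x y) = x\<close>, and preserves the last by
    \<open>l_comp\<close>.\<close>
  have ff: "f x (f y h) z = (if z = x then 1 else 0) + (if z = l x y then 1 else 0) +
      h (inv_into UNIV (s x \<circ> s y) z)" if "x \<in> X" "y \<in> X" for x y z h
  proof -
    have "inv_into UNIV (s x) z = y \<longleftrightarrow> z = l x y"
      using bij_s[OF that(1)] that
      by (metis s_def bij_inv_eq_iff)
    then show ?thesis
      using bij_s that by (simp add: f_def o_inv_distrib)
  qed
  have "f x \<circ> f y = f (l x y) \<circ> f (\<rho> x y)" if "x \<in> X" "y \<in> X" for x y
  proof -
    have eq: "s x \<circ> s y = s (l x y) \<circ> s (\<rho> x y)"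
      using that by (auto simp: s_def l_comp)
    show ?thesis
      by (intro ext) (use that in \<open>simp add: ff eq\<close>)
  qed
  moreover have "f x \<in> carrier (BijGroup UNIV)" if "x \<in> X" for x
    using f[OF that] by (simp add: BijGroup_def Bij_def)
  moreover have "a \<otimes>\<^bsub>BijGroup UNIV\<^esub> b = a \<circ> b"
    if "a \<in> carrier (BijGroup UNIV)" "b \<in> carrier (BijGroup UNIV)" for a b :: "('a \<Rightarrow> int) \<Rightarrow> 'a \<Rightarrow> int"
    using that by (auto simp: BijGroup_def compose_def)
  ultimately obtain h where "h \<in> hom G (BijGroup (UNIV :: ('a \<Rightarrow> int) set))"
    "\<And>x. x \<in> X \<Longrightarrow> h (e x) = f x"
    using universal_property[OF group_BijGroup, of f] by (metis l_closed \<rho>_closed)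
  then show ?thesis by (intro bexI[of _ h]) (simp_all add: f_def fun_eq_iff)
qed

text \<open>In the affine action, \<open>e x\<close> moves the zero function to the indicator of
  \<open>x\<close>, from which \<open>x\<close> can be read off.\<close>

lemma inj_e: "inj_on e X"
proof -
  obtain h where h: "h \<in> hom G (BijGroup (UNIV :: ('a \<Rightarrow> int) set))"
    "\<And>x. x \<in> X \<Longrightarrow> h (e x) (\<lambda>_. 0) = (\<lambda>y. if y = x then 1 else 0)"
    using affine_action by blast
  show ?thesis
  proof (rule inj_onI)
    fix x y assume xy: "x \<in> X" "y \<in> X" "e x = e y"
    then have "(\<lambda>z. if z = x then 1 else 0 :: int) = (\<lambda>z. if z = y then 1 else 0)"
      by (simp flip: h(2))
    from fun_cong[OF this, of x] show "x = y" by (simp split: if_splits)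
  qed
qed

lemma e_neq_one:
  assumes "x \<in> X"
  shows "e x \<noteq> \<one>\<^bsub>G\<^esub>"
proof
  assume eq: "e x = \<one>\<^bsub>G\<^esub>"
  obtain h where h: "h \<in> hom G (BijGroup (UNIV :: ('a \<Rightarrow> int) set))"
    "\<And>x. x \<in> X \<Longrightarrow> h (e x) (\<lambda>_. 0) = (\<lambda>y. if y = x then 1 else 0)"
    using affine_action by blast
  interpret group_hom G "BijGroup (UNIV :: ('a \<Rightarrow> int) set)" h
    using h(1) by (simp add: group_hom_def group_hom_axioms_def group_BijGroup)
  have "(\<lambda>_. 0) = (\<lambda>y. if y = x then 1 else (0 :: int))"
    using h(2)[OF assms] hom_one by (simp add: eq BijGroup_def)
  from fun_cong[OF this, of x] show False by simp
qed

end

section \<open>The permutation group\<close>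

context symset
begin

lemma e_subset: "e ` X \<subseteq> carrier G"
  by auto

lemma Lmap_eq_act:
  assumes "a \<in> carrier G"
  shows "Lmap X r a = act a"
proof
  fix y
  show "Lmap X r a y = act a y"
    using assms act_Bij[OF assms] inj_e
    by (cases "y \<in> X") (simp_all add: Lmap_def L_e the_inv_into_f_f Bij_def extensional_def)
qed

lemma act_eq_iff:
  assumes "a \<in> carrier G" "b \<in> carrier G"
  shows "act a = act b \<longleftrightarrow> S.act_eq a b"
proof -
  have "S.act_eq a b \<longleftrightarrow> (\<forall>y\<in>e ` X. S.L a y = S.L b y)"
    by (rule S.act_eq_from_generators) (use assms generate_e L_e in auto)
  also have "\<dots> \<longleftrightarrow> (\<forall>x\<in>X. act a x = act b x)"
    using assms inj_e by (auto simp: L_e inj_on_eq_iff)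
  also have "\<dots> \<longleftrightarrow> act a = act b"
    using assms Bij_imp_extensional[OF act_Bij] extensionalityI[of "act a" X "act b"] by auto
  finally show ?thesis by blast
qed

lemma sym_epi_act: "sym_epi act (struct_symgroup X r) (perm_symgroup (X, r))"
proof -
  interpret act: group_hom G "BijGroup X" act
    using act_hom by (simp add: group_hom_def group_hom_axioms_def group_BijGroup)
  have im: "Lmap X r ` carrier G = act ` carrier G"
    by (simp add: Lmap_eq_act)
  have "perm_braiding X r (act a) (act b) =
      (act (lact (struct_braiding X r) a b), act (ract (struct_braiding X r) a b))"
    if ab: "a \<in> carrier G" "b \<in> carrier G" for a b
  proof -
    have rep: "(SOME c. c \<in> carrier G \<and> Lmap X r c = act a) \<in> carrier G \<and>
        act (SOME c. c \<in> carrier G \<and> Lmap X r c = act a) = act a" if "a \<in> carrier G" for a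
    proof -
      have "\<exists>c. c \<in> carrier G \<and> Lmap X r c = act a"
        using that Lmap_eq_act by blast
      from someI_ex[OF this] show ?thesis
        using Lmap_eq_act[of "SOME c. c \<in> carrier G \<and> Lmap X r c = act a"] by argo
    qed
    \<comment> \<open>The arbitrary preimages chosen by \<open>perm_braiding\<close> are congruent
      to \<open>a\<close> and \<open>b\<close>, and both actions respect the congruence.\<close>
    define a' where "a' = (SOME c. c \<in> carrier G \<and> Lmap X r c = act a)"
    define b' where "b' = (SOME c. c \<in> carrier G \<and> Lmap X r c = act b)"
    have ab': "a' \<in> carrier G" "b' \<in> carrier G" "S.act_eq a' a" "S.act_eq b' b"
      using rep[OF ab(1)] rep[OF ab(2)] ab by (simp_all add: a'_def b'_def flip: act_eq_iff)
    have "perm_braiding X r (act a) (act b) = (Lmap X r (S.L a' b'), Lmap X r (S.R a' b'))"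
      using ab by (simp add: perm_braiding_def perm_group_def im Let_def a'_def b'_def)
    also have "\<dots> = (act (S.L a b), act (S.R a b))"
      using ab ab' by (simp add: Lmap_eq_act act_eq_iff S.act_eq_L S.act_eq_R)
    finally show ?thesis .
  qed
  then show ?thesis
    using act.hom_one act.hom_mult
    unfolding sym_epi_def perm_symgroup_def struct_symgroup_def fst_conv snd_conv perm_group_def
    by (simp add: im S.braiding_eq)
qed

lemma symgroup_struct: "symgroup (struct_symgroup X r)"
  by (simp add: struct_symgroup_def symmetric_group_struct)

lemma symgroup_perm: "symgroup (perm_symgroup (X, r))"
  by (rule sym_epi_symgroup[OF symgroup_struct sym_epi_act])

lemma sym_iso_RetG_struct: "sym_iso (RetG (struct_symgroup X r)) (perm_symgroup (X, r))"
  by (rule sym_iso_same_kernel[OF symgroup_struct sym_epi_RetG[OF symgroup_struct] sym_epi_act])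
     (simp add: struct_symgroup_def S.grp_rep_eq_iff act_eq_iff)

text \<open>Rules out level 0 for \<open>G\<close>, which accounts for the shift by one in the
  comparison of multipermutation levels.\<close>

lemma struct_not_singleton: "carrier G \<noteq> {g}"
proof -
  obtain x where "x \<in> X" using symset by (auto simp: symmetric_set_def)
  then have "e x \<in> carrier G" "\<one>\<^bsub>G\<^esub> \<in> carrier G" "e x \<noteq> \<one>\<^bsub>G\<^esub>" by (simp_all add: e_neq_one)
  then show ?thesis by blast
qed

section \<open>The retraction of a symmetric set\<close>

abbreviation q where "q \<equiv> set_rep X r"

lemma act_eq_e_iff:
  assumes "x \<in> X" "y \<in> X"
  shows "S.act_eq (e x) (e y) \<longleftrightarrow> (\<forall>z\<in>X. l x z = l y z)"
  using assms by (auto simp: act_e_restrict restrict_def fun_eq_iff simp flip: act_eq_iff)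

lemma set_rep:
  assumes "x \<in> X"
  shows "q x \<in> X" "z \<in> X \<Longrightarrow> l (q x) z = l x z"
proof -
  have "\<exists>y. y \<in> X \<and> (\<forall>z\<in>X. l y z = l x z)" using assms by blast
  from someI_ex[OF this] show "q x \<in> X" "z \<in> X \<Longrightarrow> l (q x) z = l x z"
    unfolding set_rep_def by blast+
qed

lemma set_rep_eq_iff:
  assumes "x \<in> X" "y \<in> X"
  shows "q x = q y \<longleftrightarrow> S.act_eq (e x) (e y)"
proof
  assume "q x = q y"
  then show "S.act_eq (e x) (e y)"
    using set_rep[OF assms(1)] set_rep[OF assms(2)] assms by (simp add: act_eq_e_iff)
next
  assume "S.act_eq (e x) (e y)"
  then have "(\<lambda>w. w \<in> X \<and> (\<forall>z\<in>X. l w z = l x z)) = (\<lambda>w. w \<in> X \<and> (\<forall>z\<in>X. l w z = l y z))"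
    using assms by (simp add: act_eq_e_iff)
  then show "q x = q y" by (simp add: set_rep_def)
qed

text \<open>The retraction relation on \<open>X\<close> is the restriction of
  \<open>S.act_eq\<close> along \<open>e\<close>, so compatibility is inherited from
  \<open>G\<close>.\<close>

lemma set_rep_congruence:
  assumes [simp]: "x \<in> X" "x' \<in> X" "y \<in> X" "y' \<in> X" and "q x = q x'" "q y = q y'"
  shows "q (l x y) = q (l x' y')" "q (\<rho> x y) = q (\<rho> x' y')"
proof -
  have eq: "S.act_eq (e x) (e x')" "S.act_eq (e y) (e y')" using assms by (simp_all flip: set_rep_eq_iff)
  show "q (l x y) = q (l x' y')"
    using S.act_eq_L[OF _ _ _ _ eq] by (simp add: set_rep_eq_iff L_e)
  show "q (\<rho> x y) = q (\<rho> x' y')"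
    using S.act_eq_R[OF _ _ _ _ eq] by (simp add: set_rep_eq_iff R_e)
qed

abbreviation X' where "X' \<equiv> fst (RetS (X, r))"
abbreviation r' where "r' \<equiv> snd (RetS (X, r))"

lemma carrier_RetS: "X' = q ` X"
  by (simp add: RetS_def)

lemma RetS_map:
  assumes "x \<in> X" "y \<in> X"
  shows "r' (q x) (q y) = (q (l x y), q (\<rho> x y))"
proof -
  have idem: "q (q z) = q z" if "z \<in> X" for z
    using set_rep[OF that] that by (simp add: set_rep_eq_iff act_eq_e_iff)
  have "r' (q x) (q y) = (q (l (q x) (q y)), q (\<rho> (q x) (q y)))"
    by (simp add: RetS_def map_prod_def case_prod_beta)
  then show ?thesis
    using set_rep_congruence[of "q x" x "q y" y] assms idem set_rep(1) by simp
qed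

text \<open>\<open>X\<close> may be infinite, so bijectivity of \<open>l x\<close> does not by
  itself give injectivity on classes. The inverse of \<open>e x\<close> exists in \<open>G\<close>,
  and its action respects the congruence.\<close>

lemma l_cancel_Ret:
  assumes [simp]: "x \<in> X" "y \<in> X" "z \<in> X" and "q (l x y) = q (l x z)"
  shows "q y = q z"
proof -
  have "S.act_eq (S.L (e x) (e y)) (S.L (e x) (e z))"
    using assms(4) by (simp add: set_rep_eq_iff L_e)
  moreover have "S.act_eq (inv\<^bsub>G\<^esub> e x) (inv\<^bsub>G\<^esub> e x)"
    by (simp add: S.act_eq_def)
  ultimately have "S.act_eq (S.L (inv\<^bsub>G\<^esub> e x) (S.L (e x) (e y))) (S.L (inv\<^bsub>G\<^esub> e x) (S.L (e x) (e z)))"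
    by - (rule S.act_eq_L, simp_all)
  then show ?thesis by (simp add: set_rep_eq_iff)
qed

lemma \<rho>_cancel_Ret:
  assumes [simp]: "x \<in> X" "y \<in> X" "z \<in> X" and "q (\<rho> y x) = q (\<rho> z x)"
  shows "q y = q z"
proof -
  have "S.act_eq (S.R (e y) (e x)) (S.R (e z) (e x))"
    using assms(4) by (simp add: set_rep_eq_iff R_e)
  moreover have "S.act_eq (inv\<^bsub>G\<^esub> e x) (inv\<^bsub>G\<^esub> e x)"
    by (simp add: S.act_eq_def)
  ultimately have "S.act_eq (S.R (S.R (e y) (e x)) (inv\<^bsub>G\<^esub> e x)) (S.R (S.R (e z) (e x)) (inv\<^bsub>G\<^esub> e x))"
    by - (rule S.act_eq_R, simp_all)
  then show ?thesis by (simp add: set_rep_eq_iff)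
qed

lemma symmetric_set_RetS: "symmetric_set X' r'"
proof -
  have nonempty: "X' \<noteq> {}" using symset by (simp add: carrier_RetS symmetric_set_def)
  have closed: "r' x y \<in> X' \<times> X'" if "x \<in> X'" "y \<in> X'" for x y
    using that by (auto simp: carrier_RetS RetS_map)
  have invol: "(\<lambda>(a, b). r' a b) (r' x y) = (x, y)" if "x \<in> X'" "y \<in> X'" for x y
    using that by (auto simp: carrier_RetS RetS_map)
  have bij: "bij_betw (\<lambda>(x, y). r' x y) (X' \<times> X') (X' \<times> X')"
    by (rule bij_betw_byWitness[where f' = "\<lambda>(x, y). r' x y"])
       (use closed invol in \<open>fastforce+\<close>)
  have left: "bij_betw (\<lambda>y. fst (r' x y)) X' X'" if x: "x \<in> X'" for x
  proof -
    obtain w where w: "w \<in> X" "x = q w" using x by (auto simp: carrier_RetS)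
    have "inj_on (\<lambda>y. fst (r' x y)) X'"
    proof (rule inj_onI)
      fix y z assume y: "y \<in> X'" and z: "z \<in> X'" and eq: "fst (r' x y) = fst (r' x z)"
      obtain u v where uv: "u \<in> X" "v \<in> X" "y = q u" "z = q v"
        using y z by (auto simp: carrier_RetS)
      show "y = z"
        using l_cancel_Ret[OF w(1) uv(1,2)] eq w uv by (simp add: RetS_map)
    qed
    moreover have "(\<lambda>y. fst (r' x y)) ` X' = q ` l w ` X"
      using w by (auto simp: carrier_RetS RetS_map image_image)
    moreover have "l w ` X = X" using l_bij[OF w(1)] by (simp add: bij_betw_def)
    ultimately show ?thesis by (simp add: bij_betw_def carrier_RetS)
  qed
  have right: "bij_betw (\<lambda>y. snd (r' y x)) X' X'" if x: "x \<in> X'" for x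
  proof -
    obtain w where w: "w \<in> X" "x = q w" using x by (auto simp: carrier_RetS)
    have "inj_on (\<lambda>y. snd (r' y x)) X'"
    proof (rule inj_onI)
      fix y z assume y: "y \<in> X'" and z: "z \<in> X'" and eq: "snd (r' y x) = snd (r' z x)"
      obtain u v where uv: "u \<in> X" "v \<in> X" "y = q u" "z = q v"
        using y z by (auto simp: carrier_RetS)
      show "y = z"
        using \<rho>_cancel_Ret[OF w(1) uv(1,2)] eq w uv by (simp add: RetS_map)
    qed
    moreover have "(\<lambda>y. snd (r' y x)) ` X' = q ` (\<lambda>y. \<rho> y w) ` X"
      using w by (auto simp: carrier_RetS RetS_map image_image)
    moreover have "(\<lambda>y. \<rho> y w) ` X = X" using \<rho>_bij[OF w(1)] by (simp add: bij_betw_def)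
    ultimately show ?thesis by (simp add: bij_betw_def carrier_RetS)
  qed
  have braid: "r12 r' (r23 r' (r12 r' t)) = r23 r' (r12 r' (r23 r' t))" if t: "t \<in> X' \<times> X' \<times> X'" for t
  proof -
    obtain x y z where xyz: "x \<in> X" "y \<in> X" "z \<in> X" "t = (q x, q y, q z)"
      using t by (auto simp: carrier_RetS)
    have "r12 r (r23 r (r12 r (x, y, z))) = r23 r (r12 r (r23 r (x, y, z)))"
      using symset xyz unfolding symmetric_set_def by blast
    then show ?thesis using xyz by (simp add: r12_def r23_def RetS_map case_prod_beta prod_eq_iff)
  qed
  show ?thesis
    unfolding symmetric_set_def by (intro conjI ballI nonempty bij left right invol braid)
qed

text \<open>Both groups are images of \<open>G\<close>, and in both cases \<open>a\<close> and \<open>b\<close> are identified exactly when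
  \<open>a \<cdot> x\<close> and \<open>b \<cdot> x\<close> have the same image in the permutation group for all \<open>x \<in> X\<close>.\<close>
theorem sym_iso_RetG_perm: "sym_iso (RetG (perm_symgroup (X, r))) (perm_symgroup (RetS (X, r)))"
proof -
  interpret Ret: symset X' r' by unfold_locales (rule symmetric_set_RetS)
  interpret P: symgrp "fst (perm_symgroup (X, r))" "snd (perm_symgroup (X, r))"
    by unfold_locales (rule symgroup_perm)
  have q_closed: "q x \<in> X'" if "x \<in> X" for x using that by (simp add: carrier_RetS)
  have rel: "Ret.e (q x) \<otimes>\<^bsub>Ret.G\<^esub> Ret.e (q y) = Ret.e (q (l x y)) \<otimes>\<^bsub>Ret.G\<^esub> Ret.e (q (\<rho> x y))"
    if "x \<in> X" "y \<in> X" for x y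
    using Ret.e_mult[of "q x" "q y"] q_closed that by (simp add: RetS_map)
  \<comment> \<open>The homomorphism of structure groups induced by the retraction
    \<open>q\<close>.\<close>
  obtain \<phi> where \<phi>: "\<phi> \<in> hom G Ret.G" "\<And>x. x \<in> X \<Longrightarrow> \<phi> (e x) = Ret.e (q x)"
    using universal_property[OF Ret.G.is_group, of "\<lambda>x. Ret.e (q x)"] rel q_closed Ret.e_closed
    by metis
  interpret \<phi>: group_hom G Ret.G \<phi>
    using \<phi>(1) by unfold_locales
  have "\<phi> ` e ` X = Ret.e ` X'"
    using \<phi>(2) by (force simp: carrier_RetS image_image)
  then have "\<phi> ` carrier G = carrier Ret.G"
    using \<phi>.generate_img[OF e_subset] by (simp add: generate_e Ret.generate_e)
  moreover have "struct_braiding X' r' (\<phi> a) (\<phi> b) = map_prod \<phi> \<phi> (struct_braiding X r a b)"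
    if "a \<in> carrier G" "b \<in> carrier G" for a b
  proof (rule hom_braiding_from_generators[OF symmetric_group_struct Ret.symmetric_group_struct \<phi>(1), of "e ` X"])
    show "S.L y ` e ` X = e ` X" if y: "y \<in> e ` X" for y
    proof -
      obtain x where x: "x \<in> X" "y = e x" using y by blast
      have "S.L y ` e ` X = e ` l x ` X" using x by (simp add: image_image L_e)
      then show ?thesis using l_bij[OF x(1)] by (simp add: bij_betw_def)
    qed
    show "\<phi> (S.L y z) = Ret.S.L (\<phi> y) (\<phi> z)" if "y \<in> e ` X" "z \<in> e ` X" for y z
      using that by (auto simp: L_e Ret.L_e \<phi>(2) q_closed RetS_map)
  qed (rule e_subset generate_e that)+
  ultimately have epi_\<phi>: "sym_epi \<phi> (struct_symgroup X r) (struct_symgroup X' r')"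
    by (simp add: sym_epi_def struct_symgroup_def)
  have epi': "sym_epi Ret.act (struct_symgroup X' r') (perm_symgroup (RetS (X, r)))"
    using Ret.sym_epi_act by simp
  note L_act = sym_epiD(3)[OF sym_epi_act, unfolded struct_symgroup_def fst_conv snd_conv]
  have act_im: "act ` carrier G = carrier (fst (perm_symgroup (X, r)))"
    using sym_epi_act by (simp add: sym_epi_def struct_symgroup_def)
  interpret act: group_hom G "fst (perm_symgroup (X, r))" act
    using sym_epi_act by unfold_locales (auto simp: hom_def sym_epi_def struct_symgroup_def)
  show ?thesis
  proof (rule sym_iso_same_kernel[OF symgroup_struct
        sym_epi_comp[OF sym_epi_act sym_epi_RetG[OF symgroup_perm]] sym_epi_comp[OF epi_\<phi> epi']])
    fix a b assume "a \<in> carrier (fst (struct_symgroup X r))" "b \<in> carrier (fst (struct_symgroup X r))"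
    then have ab [simp]: "a \<in> carrier G" "b \<in> carrier G" by (simp_all add: struct_symgroup_def)
    have [simp]: "act a \<in> carrier (fst (perm_symgroup (X, r)))" if "a \<in> carrier G" for a
      using that act_im by blast
    have \<phi>_L: "Ret.S.L (\<phi> c) (Ret.e (q x)) = Ret.e (q (act c x))" if "c \<in> carrier G" "x \<in> X" for c x
      using sym_epiD(3)[OF epi_\<phi>, of c "e x"] that by (simp add: struct_symgroup_def L_e \<phi>(2))
    have "P.act_eq (act a) (act b) \<longleftrightarrow> (\<forall>y\<in>act ` e ` X. P.L (act a) y = P.L (act b) y)"
    proof (rule P.act_eq_from_generators)
      show "generate (fst (perm_symgroup (X, r))) (act ` e ` X) = carrier (fst (perm_symgroup (X, r)))"
        using act.generate_img[OF e_subset] act_im by (simp add: generate_e)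
      show "P.L c y \<in> act ` e ` X" if "c \<in> carrier (fst (perm_symgroup (X, r)))" "y \<in> act ` e ` X" for c y
        using that by (auto simp: L_e simp flip: act_im L_act)
    qed auto
    also have "\<dots> \<longleftrightarrow> (\<forall>x\<in>X. act (e (act a x)) = act (e (act b x)))"
      by (simp add: L_e flip: L_act)
    \<comment> \<open>Equality of \<open>act (e y)\<close> and \<open>act (e z)\<close> says that
      \<open>q y = q z\<close>, which by injectivity of \<open>Ret.e\<close> can be tested in
      \<open>Ret.G\<close>.\<close>
    also have "\<dots> \<longleftrightarrow> (\<forall>x\<in>X. Ret.S.L (\<phi> a) (Ret.e (q x)) = Ret.S.L (\<phi> b) (Ret.e (q x)))"
      using Ret.inj_e q_closed by (simp add: \<phi>_L inj_on_eq_iff set_rep_eq_iff act_eq_iff)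
    also have "\<dots> \<longleftrightarrow> (\<forall>y\<in>Ret.e ` X'. Ret.S.L (\<phi> a) y = Ret.S.L (\<phi> b) y)"
      by (simp add: carrier_RetS)
    also have "\<dots> \<longleftrightarrow> Ret.S.act_eq (\<phi> a) (\<phi> b)"
      by (rule Ret.S.act_eq_from_generators[symmetric]) (auto simp: Ret.generate_e Ret.L_e)
    finally show "(grp_rep (fst (perm_symgroup (X, r))) (snd (perm_symgroup (X, r))) \<circ> act) a =
        (grp_rep (fst (perm_symgroup (X, r))) (snd (perm_symgroup (X, r))) \<circ> act) b \<longleftrightarrow>
        (Ret.act \<circ> \<phi>) a = (Ret.act \<circ> \<phi>) b"
      by (simp add: P.grp_rep_eq_iff Ret.act_eq_iff)
  qed
qed

end

section \<open>Iterated retractions and multipermutation level\<close>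

lemma symset_RetS_funpow:
  assumes "symset X r"
  shows "symset (fst ((RetS ^^ j) (X, r))) (snd ((RetS ^^ j) (X, r)))"
proof (induction j)
  case 0
  then show ?case using assms by simp
next
  case (Suc j)
  then interpret symset "fst ((RetS ^^ j) (X, r))" "snd ((RetS ^^ j) (X, r))" .
  show ?case using symmetric_set_RetS by (simp add: symset_def)
qed

text \<open>One retraction passes from \<open>G\<close> to its permutation group; each further one
  is moved inside by \<open>sym_iso_RetG_perm\<close>, applied to the symmetric set reached so
  far.\<close>

lemma sym_iso_RetG_funpow_struct:
  assumes "symset X r"
  shows "sym_iso ((RetG ^^ Suc j) (struct_symgroup X r)) (perm_symgroup ((RetS ^^ j) (X, r)))"
proof (induction j)
  case 0
  interpret symset X r by (rule assms)
  show ?case using sym_iso_RetG_struct by simp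
next
  case (Suc j)
  interpret symset X r by (rule assms)
  interpret j: symset "fst ((RetS ^^ j) (X, r))" "snd ((RetS ^^ j) (X, r))"
    by (rule symset_RetS_funpow[OF assms])
  interpret Sj: symset "fst ((RetS ^^ Suc j) (X, r))" "snd ((RetS ^^ Suc j) (X, r))"
    by (rule symset_RetS_funpow[OF assms])
  let ?S = "(RetG ^^ Suc j) (struct_symgroup X r)"
  have S: "symgroup ?S" by (rule symgroup_RetG_funpow[OF symgroup_struct])
  have P: "symgroup (perm_symgroup ((RetS ^^ j) (X, r)))" using j.symgroup_perm by simp
  have P': "symgroup (perm_symgroup ((RetS ^^ Suc j) (X, r)))" using Sj.symgroup_perm by simp
  have "sym_iso (RetG ?S) (RetG (perm_symgroup ((RetS ^^ j) (X, r))))"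
    by (rule sym_iso_RetG[OF S P Suc.IH])
  moreover have "sym_iso (RetG (perm_symgroup ((RetS ^^ j) (X, r)))) (perm_symgroup ((RetS ^^ Suc j) (X, r)))"
    using j.sym_iso_RetG_perm by simp
  ultimately have "sym_iso (RetG ?S) (perm_symgroup ((RetS ^^ Suc j) (X, r)))"
    by (rule sym_iso_trans[OF symgroup_RetG[OF S] symgroup_RetG[OF P] P'])
  then show ?case by simp
qed

theorem mainTheorem8:
  fixes X :: "'a set" and r :: "'a \<Rightarrow> 'a \<Rightarrow> 'a \<times> 'a"
  assumes "symmetric_set X r"
  shows "sym_iso (RetG (perm_symgroup (X, r))) (perm_symgroup (RetS (X, r))) \<and>
         (\<forall>j::nat. sym_iso ((RetG ^^ (Suc j)) (struct_symgroup X r))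
                          (perm_symgroup ((RetS ^^ j) (X, r)))) \<and>
         (\<forall>m::nat. mplG (struct_symgroup X r) (Suc m) \<longleftrightarrow> mplG (perm_symgroup (X, r)) m)"
proof -
  interpret symset X r using assms by unfold_locales
  let ?sing = "\<lambda>S k. \<exists>g. carrier (fst ((RetG ^^ k) S)) = {g}"
  have sing_Suc: "?sing (struct_symgroup X r) (Suc k) \<longleftrightarrow> ?sing (perm_symgroup (X, r)) k" for k
    using sym_iso_singleton[OF sym_iso_RetG_funpow[OF symgroup_RetG[OF symgroup_struct] symgroup_perm
          sym_iso_RetG_struct], of k]
    unfolding funpow_Suc_right comp_def .
  \<comment> \<open>Splitting \<open>k < Suc m\<close> into \<open>k = 0\<close> and successors
    leaves this extra condition in the minimality clause for \<open>G\<close>.\<close>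
  have "\<not> ?sing (struct_symgroup X r) 0"
    using struct_not_singleton by (simp add: struct_symgroup_def)
  then have "mplG (struct_symgroup X r) (Suc m) \<longleftrightarrow> mplG (perm_symgroup (X, r)) m" for m
    unfolding mplG_def All_less_Suc2 sing_Suc by simp
  then show ?thesis
    using sym_iso_RetG_perm sym_iso_RetG_funpow_struct[OF symset_axioms] by blast
qed

end
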